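(* Let $\mathbb{F}$ be a subfield of a local field (with the inherited topology). Then $\mathrm{SL}(2^k,\mathbb{F})$ is minimal for every positive integer $k$. If $\mathrm{char}(\mathbb{F})=2$, then $\mathrm{SL}(2^k,\mathbb{F})$ is totally minimal for every positive integer $k$.
   Context: A local field is a non-discrete locally compact (Hausdorff) topological field. $\mathrm{SL}(n,\mathbb{F})$ is the group of $n\times n$ matrices of determinant $1$ with the pointwise topology inherited from $\mathbb{F}^{n^2}$. All topological groups are Hausdorff. A topological group is minimal if it admits no strictly coarser Hausdorff group topology; $G$ is totally minimal if every Hausdorff quotient group $G/N$ ($N$ a closed normal subgroup) is minimal. *)

theory Defs
  imports
    "HOL-Analysis.Abstract_Topological_Spaces"
    "HOL-Algebra.Coset"
    "HOL-Algebra.Subrings"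
    "Jordan_Normal_Form.Determinant"
    "Jordan_Normal_Form.VS_Connect"
begin

section \<open>Local fields\<close>

definition topological_field :: "'a::field topology \<Rightarrow> bool" where
  "topological_field T \<longleftrightarrow>
     topspace T = UNIV \<and>
     continuous_map (prod_topology T T) T (\<lambda>(x, y). x + y) \<and>
     continuous_map T T (\<lambda>x. - x) \<and>
     continuous_map (prod_topology T T) T (\<lambda>(x, y). x * y) \<and>
     continuous_map (subtopology T (- {0})) T inverse"

definition local_field :: "'a::field topology \<Rightarrow> bool" where
  "local_field T \<longleftrightarrow>
     topological_field T \<and> Hausdorff_space T \<and> locally_compact_space T \<and>
     T \<noteq> discrete_topology UNIV"


section \<open>Minimal and totally minimal topological groups\<close>

text \<open>Topological groups are Hausdorff by convention.\<close>

definition topological_group :: "('g, 'b) monoid_scheme \<Rightarrow> 'g topology \<Rightarrow> bool" where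
  "topological_group G T \<longleftrightarrow>
     group G \<and> topspace T = carrier G \<and> Hausdorff_space T \<and>
     continuous_map (prod_topology T T) T (\<lambda>(x, y). x \<otimes>\<^bsub>G\<^esub> y) \<and>
     continuous_map T T (\<lambda>x. inv\<^bsub>G\<^esub> x)"

definition minimal_group :: "('g, 'b) monoid_scheme \<Rightarrow> 'g topology \<Rightarrow> bool" where
  "minimal_group G T \<longleftrightarrow>
     topological_group G T \<and>
     (\<forall>S. topological_group G S \<and> (\<forall>U. openin S U \<longrightarrow> openin T U) \<longrightarrow> S = T)"

definition quotient_group_topology ::
    "('g, 'b) monoid_scheme \<Rightarrow> 'g set \<Rightarrow> 'g topology \<Rightarrow> 'g set topology" where
  "quotient_group_topology G N T =
     topology (\<lambda>U. U \<subseteq> carrier (G Mod N) \<and> openin T {x \<in> carrier G. N #>\<^bsub>G\<^esub> x \<in> U})"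

lemma openin_quotient_group_topology:
  "openin (quotient_group_topology G N T) U \<longleftrightarrow>
     U \<subseteq> carrier (G Mod N) \<and> openin T {x \<in> carrier G. N #>\<^bsub>G\<^esub> x \<in> U}"
proof -
  let ?P = "\<lambda>U. U \<subseteq> carrier (G Mod N) \<and> openin T {x \<in> carrier G. N #>\<^bsub>G\<^esub> x \<in> U}"
  have "istopology ?P"
    unfolding istopology_def
  proof (intro conjI allI impI)
    fix A B assume "?P A" "?P B"
    moreover have "{x \<in> carrier G. N #>\<^bsub>G\<^esub> x \<in> A \<inter> B} =
        {x \<in> carrier G. N #>\<^bsub>G\<^esub> x \<in> A} \<inter> {x \<in> carrier G. N #>\<^bsub>G\<^esub> x \<in> B}"
      by auto
    ultimately show "A \<inter> B \<subseteq> carrier (G Mod N)"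
      and "openin T {x \<in> carrier G. N #>\<^bsub>G\<^esub> x \<in> A \<inter> B}"
      by auto
  next
    fix K assume K: "\<forall>A\<in>K. ?P A"
    then show "\<Union>K \<subseteq> carrier (G Mod N)" by blast
    have "{x \<in> carrier G. N #>\<^bsub>G\<^esub> x \<in> \<Union>K} = (\<Union>A\<in>K. {x \<in> carrier G. N #>\<^bsub>G\<^esub> x \<in> A})"
      by auto
    then show "openin T {x \<in> carrier G. N #>\<^bsub>G\<^esub> x \<in> \<Union>K}"
      using K by auto
  qed
  then show ?thesis
    unfolding quotient_group_topology_def by (simp add: topology_inverse')
qed

lemma quotient_map_quotient_group_topology:
  assumes "topspace T = carrier G"
  shows "quotient_map T (quotient_group_topology G N T) (\<lambda>x. N #>\<^bsub>G\<^esub> x)"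
proof -
  have car: "carrier (G Mod N) = (\<lambda>x. N #>\<^bsub>G\<^esub> x) ` carrier G"
    by (auto simp: FactGroup_def RCOSETS_def)
  have "{x \<in> carrier G. N #>\<^bsub>G\<^esub> x \<in> carrier (G Mod N)} = topspace T"
    using car assms by auto
  then have "openin (quotient_group_topology G N T) (carrier (G Mod N))"
    by (simp add: openin_quotient_group_topology)
  then have "topspace (quotient_group_topology G N T) = carrier (G Mod N)"
    by (meson openin_quotient_group_topology openin_subset openin_topspace subset_antisym)
  then show ?thesis
    using assms by (simp add: quotient_map_def openin_quotient_group_topology car)
qed

definition totally_minimal_group :: "('g, 'b) monoid_scheme \<Rightarrow> 'g topology \<Rightarrow> bool" where
  "totally_minimal_group G T \<longleftrightarrow>
     topological_group G T \<and>
     (\<forall>N. N \<lhd> G \<and> closedin T N \<longrightarrow>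
        minimal_group (G Mod N) (quotient_group_topology G N T))"


section \<open>Special linear groups over subfields\<close>

definition SL :: "nat \<Rightarrow> 'a::field set \<Rightarrow> 'a mat monoid" where
  "SL n F =
     \<lparr>carrier = {A \<in> carrier_mat n n. (\<forall>i<n. \<forall>j<n. A $$ (i, j) \<in> F) \<and> det A = 1},
      mult = (*), one = 1\<^sub>m n\<rparr>"

text \<open>The restriction to valid index pairs is essential: points of a product topology
  are extensional functions.\<close>

definition SL_topology :: "nat \<Rightarrow> 'a::field set \<Rightarrow> 'a topology \<Rightarrow> 'a mat topology" where
  "SL_topology n F T =
     pullback_topology (carrier (SL n F))
       (\<lambda>A. restrict (\<lambda>ij. A $$ ij) ({..<n} \<times> {..<n}))
       (product_topology (\<lambda>_. subtopology T F) ({..<n} \<times> {..<n}))"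

lemma topspace_SL_topology:
  assumes "topspace T = UNIV"
  shows "topspace (SL_topology n F T) = carrier (SL n F)"
  using assms
  by (auto simp: SL_topology_def topspace_pullback_topology SL_def PiE_iff)

end

theory Submission
  imports Defs
begin

text \<open>
  Let \<open>S\<close> be a Hausdorff group topology on \<open>SL n F\<close> coarser than the given one, and let the
  limit kernel be the set of all matrices over the ambient local field that are entrywise limits of
  filters converging to the identity in \<open>S\<close>. It is a closed subset, stable under products,
  inverses and conjugation by \<open>SL n F\<close>, and it meets \<open>SL n F\<close> only in the identity.
  A nonscalar member would yield, by contracting suitable commutators with a torus, a nontrivial
  elementary matrix over \<open>F\<close> in the kernel; a scalar member is a root of unity of order
  a power of two, so if nontrivial it has \<open>-1 \<noteq> 1\<close> among its powers. Hence the kernel is trivial.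

  Now let an ultrafilter of matrices \<open>g\<close> converge to the identity in \<open>S\<close>. If the entries
  of \<open>g\<close> converge, the limit is in the kernel and we are done. Otherwise the inverses
  \<open>c\<close> and \<open>d\<close> of dominant entries of \<open>g\<close> and of its inverse \<open>h\<close> tend to \<open>0\<close>,
  and \<open>c g\<close>, \<open>d h\<close> tend to nonzero matrices \<open>A\<close>, \<open>B\<close> with \<open>A B = 0\<close>. So some column
  \<open>p\<close> of \<open>A\<close> and some row \<open>q \<noteq> p\<close> of \<open>B\<close> are nonzero. The elementary matrix with entry
  \<open>c d\<close> at \<open>(p, q)\<close> tends to the identity, but its conjugate by \<open>g\<close> tends to the identity
  plus the nonzero product of that column and that row, contradicting triviality of the kernel.

  In characteristic two the same contraction shows that a nontrivial closed normal subgroup contains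
  all elementary matrices, hence is the whole group. An infinite subfield of a local field is never
  discrete, and for a finite one all topologies in question are discrete.
\<close>

section \<open>Ultrafilters and limits in topological fields\<close>

definition ultrafilter :: "'a filter \<Rightarrow> bool" where
  "ultrafilter U \<longleftrightarrow> U \<noteq> bot \<and> (\<forall>P. eventually P U \<or> eventually (\<lambda>x. \<not> P x) U)"

lemma ultrafilter_neq_bot: "ultrafilter U \<Longrightarrow> U \<noteq> bot"
  by (simp add: ultrafilter_def)

lemma ultrafilter_not_eventually:
  assumes "ultrafilter U" shows "\<not> eventually P U \<longleftrightarrow> eventually (\<lambda>x. \<not> P x) U"
proof
  assume n: "eventually (\<lambda>x. \<not> P x) U"
  show "\<not> eventually P U"
  proof
    assume "eventually P U"
    with n have "eventually (\<lambda>_. False) U" by eventually_elim simp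
    then show False using ultrafilter_neq_bot[OF assms] by simp
  qed
next
  assume "\<not> eventually P U"
  then show "eventually (\<lambda>x. \<not> P x) U" using assms unfolding ultrafilter_def by blast
qed

text \<open>Zorn's lemma, with the order on proper filters below \<open>F\<close> reversed, gives a
  minimal one. Restricting a minimal filter to \<open>P\<close> either returns the same filter, so
  that \<open>P\<close> holds eventually, or gives \<open>bot\<close>, so that its negation
  does.\<close>

lemma ultrafilter_exists:
  assumes "F \<noteq> bot"
  obtains U where "ultrafilter U" "U \<le> F"
proof -
  let ?A = "{G. G \<noteq> bot \<and> G \<le> F}"
  have "\<exists>m\<in>?A. \<forall>a\<in>?A. a \<le> m \<longrightarrow> a = m"
  proof (rule predicate_Zorn)
    show "partial_order_on ?A (relation_of (\<ge>) ?A)"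
      by (auto simp: partial_order_on_def preorder_on_def refl_on_def trans_def antisym_def
          relation_of_def)
    fix C assume C: "C \<in> Chains (relation_of (\<ge>) ?A)"
    show "\<exists>u\<in>?A. \<forall>a\<in>C. u \<le> a"
    proof (cases "C = {}")
      case True
      then show ?thesis using assms by auto
    next
      case False
      have ch: "G \<le> H \<or> H \<le> G" if "G \<in> C" "H \<in> C" for G H
        using C that by (auto simp: Chains_def relation_of_def)
      have sub: "C \<subseteq> ?A" using C by (auto simp: Chains_def relation_of_def)
      \<comment> \<open>A chain is directed, so \<open>False\<close> could hold eventually in its
        infimum only if it did so in one of its members.\<close>
      have "\<not> eventually (\<lambda>_. False) (Inf C)"
      proof (subst eventually_Inf_base[OF False])
        show "\<exists>x\<in>C. x \<le> inf G H" if "G \<in> C" "H \<in> C" for G H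
          using ch[OF that] that by (auto simp: inf_absorb1 inf_absorb2)
      qed (use sub in auto)
      then have "Inf C \<noteq> bot" by auto
      moreover have "Inf C \<le> F" using False sub by (auto intro: Inf_lower2)
      ultimately show ?thesis by (auto intro: Inf_lower)
    qed
  qed
  then obtain U where U: "U \<noteq> bot" "U \<le> F"
    and U_min: "\<forall>G\<in>?A. G \<le> U \<longrightarrow> G = U" by blast
  have mini: "G = U" if "G \<noteq> bot" "G \<le> U" for G
    using U_min U(2) that by auto
  have "eventually P U \<or> eventually (\<lambda>x. \<not> P x) U" for P
  proof (cases "inf U (principal {x. P x}) = bot")
    case True
    then have "eventually (\<lambda>_. False) (inf U (principal {x. P x}))" by simp
    then show ?thesis by (simp add: eventually_inf_principal)
  next
    case False
    then have "inf U (principal {x. P x}) = U" by (rule mini) simp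
    moreover have "eventually P (inf U (principal {x. P x}))"
      by (simp add: eventually_inf_principal)
    ultimately have "eventually P U" by simp
    then show ?thesis ..
  qed
  then show ?thesis using U that unfolding ultrafilter_def by blast
qed

text \<open>If no point of \<open>C\<close> were a limit, each would have a neighbourhood that
  \<open>f\<close> eventually avoids, because an ultrafilter decides membership. Finitely many of
  these neighbourhoods cover \<open>C\<close>.\<close>

lemma ultrafilter_compact_limit:
  assumes U: "ultrafilter U" and C: "compactin X C" and f: "eventually (\<lambda>x. f x \<in> C) U"
  shows "\<exists>l\<in>C. limitin X f l U"
proof (rule ccontr)
  assume no: "\<not> ?thesis"
  have "\<exists>V. openin X V \<and> c \<in> V \<and> \<not> eventually (\<lambda>x. f x \<in> V) U" if "c \<in> C" for c
    using no that compactin_subset_topspace[OF C] by (auto simp: limitin_def)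
  then obtain V where V: "\<And>c. c \<in> C \<Longrightarrow> openin X (V c) \<and> c \<in> V c \<and> \<not> eventually (\<lambda>x. f x \<in> V c) U"
    by metis
  have "\<forall>W\<in>V ` C. openin X W" "C \<subseteq> \<Union>(V ` C)" using V by blast+
  then obtain K where K: "finite K" "K \<subseteq> V ` C" "C \<subseteq> \<Union>K"
    using C unfolding compactin_def by meson
  have "eventually (\<lambda>x. \<forall>W\<in>K. f x \<notin> W) U"
    using K V ultrafilter_not_eventually[OF U] by (intro eventually_ball_finite) auto
  with f have "eventually (\<lambda>_. False) U"
    by eventually_elim (use K in blast)
  then show False using ultrafilter_neq_bot[OF U] by simp
qed

lemma limitin_mono: "limitin X f l F \<Longrightarrow> G \<le> F \<Longrightarrow> limitin X f l G"
  by (auto simp: limitin_def le_filter_def)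

lemma limitin_filtermap: "limitin X f l (filtermap g F) \<longleftrightarrow> limitin X (\<lambda>x. f (g x)) l F"
  by (simp add: limitin_def eventually_filtermap)

lemma limitin_filterlim: "limitin X f l G \<Longrightarrow> filterlim g G F \<Longrightarrow> limitin X (\<lambda>x. f (g x)) l F"
  unfolding filterlim_def using limitin_mono limitin_filtermap by metis

lemma limitin_fst: "limitin X f l F \<Longrightarrow> limitin X (\<lambda>x. f (fst x)) l (F \<times>\<^sub>F G)"
  by (rule limitin_filterlim[OF _ filterlim_fst])

lemma limitin_snd: "limitin X f l G \<Longrightarrow> limitin X (\<lambda>x. f (snd x)) l (F \<times>\<^sub>F G)"
  by (rule limitin_filterlim[OF _ filterlim_snd])

text \<open>If convergence fails at \<open>V\<close>, then \<open>F\<close> restricted to the points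
  sent outside \<open>V\<close> is still proper, and an ultrafilter below it contradicts the
  assumption.\<close>

lemma limitin_ultrafilterI:
  assumes l: "l \<in> topspace X" and "\<And>U. ultrafilter U \<Longrightarrow> U \<le> F \<Longrightarrow> limitin X f l U"
  shows "limitin X f l F"
  unfolding limitin_def
proof (intro conjI l allI impI)
  fix V assume V: "openin X V \<and> l \<in> V"
  show "eventually (\<lambda>x. f x \<in> V) F"
  proof (rule ccontr)
    assume "\<not> ?thesis"
    then have "inf F (principal {x. f x \<notin> V}) \<noteq> bot"
      by (simp add: trivial_limit_def eventually_inf_principal)
    then obtain U where U: "ultrafilter U" "U \<le> inf F (principal {x. f x \<notin> V})"
      by (rule ultrafilter_exists)
    then have "eventually (\<lambda>x. f x \<in> V) U"
      using assms(2)[of U] V by (auto simp: limitin_def)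
    moreover have "eventually (\<lambda>x. f x \<notin> V) U"
      using U(2) by (auto simp: le_filter_def eventually_inf_principal)
    ultimately show False using ultrafilter_not_eventually[OF U(1)] by blast
  qed
qed

lemma limitin_nhdsin: "l \<in> topspace X \<Longrightarrow> limitin X (\<lambda>x. x) l F \<longleftrightarrow> F \<le> nhdsin X l"
  unfolding limitin_def le_filter_def eventually_nhdsin
  by (smt (verit, best) eventually_mono)

section \<open>Limit calculus in a Hausdorff topological field\<close>

locale top_field =
  fixes T :: "'a::field topology"
  assumes top_field: "topological_field T" and Hausdorff: "Hausdorff_space T"
begin

lemma topspace_T [simp]: "topspace T = UNIV"
  using top_field by (simp add: topological_field_def)

lemma lim_const [simp]: "limitin T (\<lambda>_. c) c F"
  by simp

lemma lim_add: "limitin T f a F \<Longrightarrow> limitin T g b F \<Longrightarrow> limitin T (\<lambda>x. f x + g x) (a + b) F"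
  using top_field continuous_map_limit[of "prod_topology T T" T "\<lambda>(x, y). x + y" "\<lambda>x. (f x, g x)" "(a, b)" F]
  by (auto simp: topological_field_def limitin_pairwise o_def)

lemma lim_mult: "limitin T f a F \<Longrightarrow> limitin T g b F \<Longrightarrow> limitin T (\<lambda>x. f x * g x) (a * b) F"
  using top_field continuous_map_limit[of "prod_topology T T" T "\<lambda>(x, y). x * y" "\<lambda>x. (f x, g x)" "(a, b)" F]
  by (auto simp: topological_field_def limitin_pairwise o_def)

lemma lim_minus: "limitin T f a F \<Longrightarrow> limitin T (\<lambda>x. - f x) (- a) F"
  using top_field continuous_map_limit[of T T uminus f a F]
  by (auto simp: topological_field_def o_def)

lemma lim_diff: "limitin T f a F \<Longrightarrow> limitin T g b F \<Longrightarrow> limitin T (\<lambda>x. f x - g x) (a - b) F"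
  using lim_add[OF _ lim_minus, of f a F g b] by simp

lemma lim_sum: "(\<And>i. i \<in> I \<Longrightarrow> limitin T (f i) (a i) F) \<Longrightarrow> limitin T (\<lambda>x. \<Sum>i\<in>I. f i x) (\<Sum>i\<in>I. a i) F"
  by (induction I rule: infinite_finite_induct) (auto intro: lim_add)

lemma lim_prod: "(\<And>i. i \<in> I \<Longrightarrow> limitin T (f i) (a i) F) \<Longrightarrow> limitin T (\<lambda>x. \<Prod>i\<in>I. f i x) (\<Prod>i\<in>I. a i) F"
  by (induction I rule: infinite_finite_induct) (auto intro: lim_mult)

lemma lim_power: "limitin T f a F \<Longrightarrow> limitin T (\<lambda>x. f x ^ n) (a ^ n) F"
  by (induction n) (auto intro: lim_mult)

lemma lim_unique: "limitin T f a F \<Longrightarrow> limitin T f b F \<Longrightarrow> F \<noteq> bot \<Longrightarrow> a = b"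
  using limitin_Hausdorff_unique Hausdorff by metis

lemma openin_compl_singleton: "openin T (- {a})"
  using Hausdorff by (metis Compl_eq_Diff_UNIV Hausdorff_imp_t1_space UNIV_I
      t1_space_openin_delete_alt openin_topspace topspace_T)

lemma lim_eventually_neq: "limitin T f a F \<Longrightarrow> a \<noteq> b \<Longrightarrow> eventually (\<lambda>x. f x \<noteq> b) F"
  using limitinD[of T f a F "- {b}"] openin_compl_singleton by auto

lemma lim_inverse:
  assumes "limitin T f a F" "a \<noteq> 0"
  shows "limitin T (\<lambda>x. inverse (f x)) (inverse a) F"
proof -
  have "limitin (subtopology T (- {0})) f a F"
    using assms lim_eventually_neq by (auto simp: limitin_subtopology)
  then show ?thesis
    using top_field continuous_map_limit[of "subtopology T (- {0})" T inverse f a F]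
    by (auto simp: topological_field_def o_def)
qed

lemma lim_eq_const: "limitin T f a F \<Longrightarrow> eventually (\<lambda>x. f x = c) F \<Longrightarrow> F \<noteq> bot \<Longrightarrow> a = c"
  using lim_unique[of f a F c] limitin_eventually[of c T f F] by auto

end

section \<open>Local compactness in place of an absolute value\<close>

locale local_top_field = top_field +
  assumes lc: "locally_compact_space T" and nondiscrete: "T \<noteq> discrete_topology UNIV"
begin

text \<open>Translations are continuous, so an open point at zero would make every point
  open.\<close>

lemma not_openin_zero: "\<not> openin T {0}"
proof
  assume o: "openin T {0}"
  have "openin T {a}" for a
  proof -
    have "continuous_map T T (\<lambda>x. x - a)"
      by (auto simp: continuous_map_atin intro!: lim_diff limitin_continuous_map[where f="\<lambda>x. x"])
    from openin_continuous_map_preimage[OF this o] show ?thesis by simp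
  qed
  then have "openin T S" for S
    using openin_Union[of "(\<lambda>a. {a}) ` S" T] by auto
  then show False using nondiscrete by (simp add: topology_eq)
qed

lemma atin_zero: "atin T 0 \<noteq> bot"
  using not_openin_zero derived_set_of_topspace[of T] nontrivial_limit_atin[of T 0] by simp

text \<open>Here \<open>s\<close> stands in for an element of absolute value below one, and
  \<open>C\<close> for a ball that \<open>s\<close> shrinks into its own part \<open>W\<close>. All
  powers of \<open>s\<close> stay in the compact set \<open>C\<close>, and comparing them with each
  other shows that zero is their only limit point.\<close>

lemma contraction_exists:
  obtains C W s where "compactin T C" "openin T W" "0 \<in> W" "W \<subseteq> C" "\<And>c. c \<in> C \<Longrightarrow> s * c \<in> W"
    "s \<noteq> 0" "limitin T (\<lambda>n. s ^ n) 0 sequentially"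
proof -
  obtain W C0 where WC: "openin T W" "compactin T C0" "0 \<in> W" "W \<subseteq> C0"
    using lc unfolding locally_compact_space_def topspace_T by (meson UNIV_I)
  \<comment> \<open>The point 1 is added so that induction from \<open>s ^ 0\<close> keeps every
    power of \<open>s\<close> in \<open>C\<close>.\<close>
  define C where "C = insert 1 C0"
  have C: "compactin T C" "W \<subseteq> C" "1 \<in> C"
    using WC compactin_Un[of T "{1}" C0] finite_imp_compactin[of "{1}" T] by (auto simp: C_def)
  have "closedin T C" by (simp add: C Hausdorff compactin_imp_closedin)
  define P where "P = {z \<in> topspace (prod_topology T T). (\<lambda>(x, y). x * y) z \<in> W}"
  have "openin (prod_topology T T) P"
    unfolding P_def using top_field WC(1)
    by (intro openin_continuous_map_preimage) (auto simp: topological_field_def)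
  moreover have "{0} \<times> C \<subseteq> P" using WC by (auto simp: P_def)
  ultimately obtain U V where UV: "openin T U" "{0} \<subseteq> U" "C \<subseteq> V" "U \<times> V \<subseteq> P"
    using Wallace_theorem_prod_topology[of T "{0}" T C P] C finite_imp_compactin[of "{0}" T] by (metis (no_types) UNIV_I empty_subsetI finite.emptyI finite_insert insert_subset topspace_T)
  have U: "u * c \<in> W" if "u \<in> U" "c \<in> C" for u c
  proof -
    have "(u, c) \<in> P" using UV that by blast
    then show ?thesis by (simp add: P_def)
  qed
  have U0: "0 \<in> U" using UV(2) by simp
  \<comment> \<open>Otherwise the inverses would stay in the compact \<open>C\<close> as
    \<open>x\<close> tends to zero and would have a limit \<open>p\<close> along an ultrafilter, so
    the constant product 1 would tend to \<open>0 * p\<close>.\<close>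
  have "\<exists>s\<in>U. s \<noteq> 0 \<and> inverse s \<notin> C"
  proof (rule ccontr)
    assume no: "\<not> ?thesis"
    obtain \<U> where u: "ultrafilter \<U>" "\<U> \<le> atin T 0"
      using atin_zero ultrafilter_exists by blast
    have l0: "limitin T (\<lambda>x. x) 0 \<U>"
      using u(2) limitin_continuous_map[of T T "\<lambda>x. x" 0 0] by (auto intro: limitin_mono)
    have ne: "eventually (\<lambda>x. x \<noteq> 0) \<U>"
    proof -
      have "eventually (\<lambda>x. x \<noteq> 0) (atin T 0)"
        unfolding eventually_atin using openin_topspace[of T] by auto
      then show ?thesis using u(2) by (auto simp: le_filter_def)
    qed
    have "eventually (\<lambda>x. inverse x \<in> C) \<U>"
      using ne limitinD[OF l0 UV(1) U0] by eventually_elim (use no in auto)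
    then obtain p where "limitin T inverse p \<U>"
      using ultrafilter_compact_limit[OF u(1) C(1)] by blast
    with l0 have "limitin T (\<lambda>x. x * inverse x) (0 * p) \<U>" by (rule lim_mult)
    then have "0 * p = 1" using ne
      using u(1) by (intro lim_eq_const) (auto elim: eventually_mono dest: ultrafilter_neq_bot)
    then show False by simp
  qed
  then obtain s where s: "s \<in> U" "s \<noteq> 0" "inverse s \<notin> C" by blast
  have sC: "s ^ n \<in> C" for n
    by (induction n) (use C U[OF s(1)] in auto)
  have "limitin T (\<lambda>n. s ^ n) 0 sequentially"
  proof (rule limitin_ultrafilterI)
    fix \<U> :: "nat filter" assume u: "ultrafilter \<U>" "\<U> \<le> sequentially"
    obtain p where p: "limitin T (\<lambda>n. s ^ n) p \<U>"
      using ultrafilter_compact_limit[OF u(1) C(1)] sC by (metis (mono_tags) eventually_True eventually_mono)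
    have "p = 0"
    proof (rule ccontr)
      assume "p \<noteq> 0"
      \<comment> \<open>The ratio of two powers alone tends to 1, which lies in \<open>C\<close>.
        The extra factor moves the limit to \<open>inverse s\<close>, outside the closed set
        \<open>C\<close>, while for exponents \<open>m > n\<close> the value is
        \<open>s ^ (m - n - 1)\<close>, which is in \<open>C\<close>.\<close>
      let ?q = "\<lambda>x. s ^ fst x * inverse (s ^ snd x) * inverse s"
      have "limitin T ?q (p * inverse p * inverse s) (\<U> \<times>\<^sub>F \<U>)"
        using \<open>p \<noteq> 0\<close> by (intro lim_mult lim_inverse lim_const limitin_fst limitin_snd p)
      then have "limitin T ?q (inverse s) (\<U> \<times>\<^sub>F \<U>)" using \<open>p \<noteq> 0\<close> by simp
      moreover have "openin T (- C)" using \<open>closedin T C\<close> by (simp add: closedin_def Compl_eq_Diff_UNIV)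
      ultimately have "eventually (\<lambda>x. ?q x \<in> - C) (\<U> \<times>\<^sub>F \<U>)"
        using s(3) limitinD by fastforce
      then obtain P where P: "eventually P \<U>" "\<And>x y. P x \<Longrightarrow> P y \<Longrightarrow> ?q (x, y) \<in> - C"
        by (auto simp: eventually_prod_same)
      obtain n where n: "P n" using P(1) u(1) by (metis eventually_happens ultrafilter_neq_bot)
      have "eventually (\<lambda>m. m > n) \<U>"
        using u(2) eventually_gt_at_top by (auto simp: le_filter_def)
      with P(1) have "eventually (\<lambda>m. P m \<and> m > n) \<U>" by eventually_elim auto
      then obtain m where m: "P m" "m > n" using u(1) by (metis (mono_tags, lifting) eventually_happens ultrafilter_neq_bot)
      then have "m = (m - n - 1) + n + 1" by simp
      then have "s ^ m = s ^ (m - n - 1) * s ^ n * s"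
        by (metis power_add power_one_right)
      then have "?q (m, n) = s ^ (m - n - 1)" using s(2) by (simp add: field_simps)
      then show False using P(2)[OF m(1) n] sC by simp
    qed
    then show "limitin T (\<lambda>n. s ^ n) 0 \<U>" using p by simp
  qed simp
  then show ?thesis using that[OF C(1) WC(1,3) C(2) U[OF s(1)] s(2)] by blast
qed

text \<open>Along an ultrafilter a function converges or tends to infinity. Each value is scaled by
  the least power of \<open>s\<close> that brings it into \<open>C\<close>; the scaled values
  converge by compactness. Either the exponent is eventually constant and \<open>f\<close>
  converges, or it tends to infinity, and then the scaled limit is nonzero.\<close>

lemma ultrafilter_limit_or_inverse_null:
  assumes U: "ultrafilter \<U>"
  shows "(\<exists>l. limitin T f l \<U>) \<or> limitin T (\<lambda>x. inverse (f x)) 0 \<U>"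
proof (cases "\<exists>l. limitin T f l \<U>")
  case no: False
  obtain C W s where CW: "compactin T C" "openin T W" "0 \<in> W" "W \<subseteq> C"
    "\<And>c. c \<in> C \<Longrightarrow> s * c \<in> W" and s: "s \<noteq> 0" "limitin T (\<lambda>n. s ^ n) 0 sequentially"
    using contraction_exists by blast
  define N where "N x = (LEAST n. s ^ n * f x \<in> C)" for x
  define y where "y x = s ^ N x * f x" for x
  have "\<exists>n. s ^ n * f x \<in> C" for x
  proof -
    have "limitin T (\<lambda>n. s ^ n * f x) (0 * f x) sequentially"
      by (intro lim_mult s lim_const)
    then have "eventually (\<lambda>n. s ^ n * f x \<in> W) sequentially"
      using CW limitinD by fastforce
    then show ?thesis using CW(4) by (auto simp: eventually_sequentially)
  qed
  then have yC: "y x \<in> C" for x unfolding y_def N_def by (metis (mono_tags, lifting) LeastI_ex)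
  then obtain l where l: "limitin T y l \<U>"
    using ultrafilter_compact_limit[OF U CW(1), of y] by auto
  have f_eq: "f x = y x * inverse s ^ N x" for x
    using s by (simp add: y_def power_inverse)
  have not_eq: "eventually (\<lambda>x. N x \<noteq> n) \<U>" for n
  proof (rule ccontr)
    assume "\<not> ?thesis"
    then have "eventually (\<lambda>x. N x = n) \<U>"
      using ultrafilter_not_eventually[OF U, of "\<lambda>x. N x \<noteq> n"] by simp
    then have "eventually (\<lambda>x. y x * inverse s ^ n = f x) \<U>"
      by eventually_elim (simp add: f_eq)
    then have "limitin T f (l * inverse s ^ n) \<U>"
      using lim_mult[OF l lim_const] by (rule limitin_transform_eventually)
    then show False using no by blast
  qed
  have gt: "eventually (\<lambda>x. N x > n) \<U>" for n
  proof (induction n)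
    case 0
    show ?case using not_eq[of 0] by eventually_elim simp
  next
    case (Suc n)
    then show ?case using not_eq[of "Suc n"] by eventually_elim simp
  qed
  then have "filterlim N sequentially \<U>"
    by (auto simp: filterlim_at_top intro: eventually_mono less_imp_le)
  then have sN: "limitin T (\<lambda>x. s ^ N x) 0 \<U>"
    by (rule limitin_filterlim[OF s(2)])
  \<comment> \<open>Were the limit zero, \<open>y x * inverse s\<close> would eventually lie in
    \<open>W\<close>. For positive \<open>N x\<close> this is the value one scaling step earlier,
    which by minimality of \<open>N x\<close> is still outside \<open>C\<close>.\<close>
  have "l \<noteq> 0"
  proof
    assume "l = 0"
    then have "limitin T (\<lambda>x. y x * inverse s) (0 * inverse s) \<U>"
      using l by (intro lim_mult) auto
    then have "eventually (\<lambda>x. y x * inverse s \<in> W) \<U>" using CW limitinD by fastforce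
    moreover have "eventually (\<lambda>x. y x * inverse s \<notin> W) \<U>"
      using gt[of 0]
    proof eventually_elim
      case (elim x)
      then have "y x * inverse s = s ^ (N x - 1) * f x"
        using s by (cases "N x") (auto simp: y_def)
      moreover have "s ^ (N x - 1) * f x \<notin> C"
        using elim not_less_Least[of "N x - 1" "\<lambda>n. s ^ n * f x \<in> C"] by (simp add: N_def)
      ultimately show ?case using CW(4) by auto
    qed
    ultimately show False using ultrafilter_not_eventually[OF U] by blast
  qed
  then have "limitin T (\<lambda>x. s ^ N x * inverse (y x)) (0 * inverse l) \<U>"
    by (intro lim_mult sN lim_inverse l)
  moreover have "s ^ N x * inverse (y x) = inverse (f x)" for x
    using s by (simp add: y_def)
  ultimately show ?thesis by simp
qed simp

text \<open>Take an ultrafilter on \<open>F\<close> that avoids every single point. If it tends to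
  infinity, the inverses accumulate at zero; if it converges, differences with a suitable fixed
  point of \<open>F\<close> enter any given neighbourhood of zero without vanishing.\<close>

lemma infinite_subfield_zero_limit_point:
  assumes diff: "\<And>x y. x \<in> F \<Longrightarrow> y \<in> F \<Longrightarrow> x - y \<in> F" and inv: "\<And>x. x \<in> F \<Longrightarrow> inverse x \<in> F"
    and inf: "infinite F"
  shows "atin_within T 0 F \<noteq> bot"
proof
  assume "atin_within T 0 F = bot"
  then have "eventually (\<lambda>_. False) (atin_within T 0 F)" by simp
  then obtain V where V: "openin T V" "0 \<in> V" "\<And>x. x \<in> V \<Longrightarrow> x \<in> F \<Longrightarrow> x = 0"
    by (auto simp: eventually_atin_within)
  have "inf cofinite (principal F) \<noteq> bot"
    using inf by (auto simp: trivial_limit_def eventually_inf_principal eventually_cofinite)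
  then obtain \<U> where U: "ultrafilter \<U>" "\<U> \<le> inf cofinite (principal F)"
    by (rule ultrafilter_exists)
  have F: "eventually (\<lambda>x. x \<in> F) \<U>"
    using U(2) by (auto simp: le_filter_def eventually_inf_principal)
  have neq: "eventually (\<lambda>x. x \<noteq> a) \<U>" for a
    using U(2) by (auto simp: le_filter_def eventually_inf_principal eventually_cofinite)
  show False
    using ultrafilter_limit_or_inverse_null[OF U(1), of "\<lambda>x. x"]
  proof
    assume "limitin T inverse 0 \<U>"
    then have "eventually (\<lambda>x. inverse x \<in> V) \<U>" using V limitinD by fastforce
    with F neq[of 0] have "eventually (\<lambda>_. False) \<U>"
      by eventually_elim (use V(3) inv in force)
    then show False using ultrafilter_neq_bot[OF U(1)] by simp
  next
    assume "\<exists>l. limitin T (\<lambda>x. x) l \<U>"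
    then obtain l where l: "limitin T (\<lambda>x. x) l \<U>" by blast
    have "limitin T (\<lambda>x. fst x - snd x) (l - l) (\<U> \<times>\<^sub>F \<U>)"
      by (intro lim_diff limitin_fst limitin_snd l)
    then have "eventually (\<lambda>x. fst x - snd x \<in> V) (\<U> \<times>\<^sub>F \<U>)"
      using V limitinD by fastforce
    then obtain P where P: "eventually P \<U>" "\<And>x y. P x \<Longrightarrow> P y \<Longrightarrow> x - y \<in> V"
      by (auto simp: eventually_prod_same)
    have PF: "eventually (\<lambda>x. P x \<and> x \<in> F) \<U>"
      using P(1) F by eventually_elim simp
    then obtain a where a: "P a" "a \<in> F"
      using ultrafilter_neq_bot[OF U(1)] by (auto dest: eventually_happens)
    have "eventually (\<lambda>_. False) \<U>"
      using PF neq[of a]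
    proof eventually_elim
      case (elim x)
      then show ?case using V(3)[OF P(2) diff, of x a] a by simp
    qed
    then show False using ultrafilter_neq_bot[OF U(1)] by simp
  qed
qed

text \<open>This replaces the choice of an entry of largest absolute value. In the induction the new
  index \<open>k\<close> either has a convergent ratio to the old dominant index \<open>r\<close>,
  or that ratio tends to infinity; then \<open>k\<close> takes over, its ratios being products of
  two convergent ones.\<close>

lemma ultrafilter_dominant:
  assumes U: "ultrafilter \<U>" and "finite I" and "\<exists>i\<in>I. eventually (\<lambda>x. f i x \<noteq> 0) \<U>"
  shows "\<exists>r\<in>I. eventually (\<lambda>x. f r x \<noteq> 0) \<U> \<and> (\<forall>i\<in>I. \<exists>l. limitin T (\<lambda>x. inverse (f r x) * f i x) l \<U>)"
  using assms(2,3)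
proof (induction I rule: finite_induct)
  case (insert k I)
  have self: "\<exists>l. limitin T (\<lambda>x. inverse (f r x) * f r x) l \<U>" if "eventually (\<lambda>x. f r x \<noteq> 0) \<U>" for r
  proof -
    have "eventually (\<lambda>x. inverse (f r x) * f r x = 1) \<U>"
      using that by eventually_elim simp
    then show ?thesis using limitin_eventually[of 1 T] by (metis UNIV_I topspace_T)
  qed
  have zero: "\<exists>l. limitin T (\<lambda>x. inverse (f r x) * f i x) l \<U>" if "\<not> eventually (\<lambda>x. f i x \<noteq> 0) \<U>" for r i
  proof -
    have "eventually (\<lambda>x. f i x = 0) \<U>"
      using that ultrafilter_not_eventually[OF U, of "\<lambda>x. f i x \<noteq> 0"] by simp
    then have "eventually (\<lambda>x. inverse (f r x) * f i x = 0) \<U>" by eventually_elim simp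
    then show ?thesis using limitin_eventually[of 0 T] by (metis UNIV_I topspace_T)
  qed
  show ?case
  proof (cases "\<exists>i\<in>I. eventually (\<lambda>x. f i x \<noteq> 0) \<U>")
    case False
    then show ?thesis using self zero insert.prems by (metis insertE insertI1)
  next
    case True
    then obtain r where r: "r \<in> I" "eventually (\<lambda>x. f r x \<noteq> 0) \<U>"
      "\<And>i. i \<in> I \<Longrightarrow> \<exists>l. limitin T (\<lambda>x. inverse (f r x) * f i x) l \<U>"
      using insert.IH by blast
    show ?thesis
    proof (cases "\<exists>l. limitin T (\<lambda>x. inverse (f r x) * f k x) l \<U>")
      case True
      then show ?thesis using r by blast
    next
      case False
      then have lim0: "limitin T (\<lambda>x. inverse (inverse (f r x) * f k x)) 0 \<U>"
        using ultrafilter_limit_or_inverse_null[OF U] by blast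
      have k: "eventually (\<lambda>x. f k x \<noteq> 0) \<U>" using False zero by blast
      have "\<exists>l. limitin T (\<lambda>x. inverse (f k x) * f i x) l \<U>" if "i \<in> I" for i
      proof -
        from r(3)[OF that] obtain l where "limitin T (\<lambda>x. inverse (f r x) * f i x) l \<U>" by blast
        note lim = lim_mult[OF lim0 this]
        have "eventually (\<lambda>x. inverse (inverse (f r x) * f k x) * (inverse (f r x) * f i x) = inverse (f k x) * f i x) \<U>"
          using r(2) by eventually_elim simp
        from limitin_transform_eventually[OF this lim] show ?thesis by blast
      qed
      then show ?thesis using k self[OF k] by blast
    qed
  qed
qed simp

end

section \<open>Matrix topologies and special linear groups\<close>

locale subfield_set =
  fixes F :: "'a::field set"
  assumes one_in [simp]: "1 \<in> F"
    and diff_in: "x \<in> F \<Longrightarrow> y \<in> F \<Longrightarrow> x - y \<in> F"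
    and mult_in: "x \<in> F \<Longrightarrow> y \<in> F \<Longrightarrow> x * y \<in> F"
    and inverse_in: "x \<in> F \<Longrightarrow> inverse x \<in> F"
begin

lemma zero_in [simp]: "0 \<in> F"
  using diff_in[of 1 1] by simp

lemma minus_in: "x \<in> F \<Longrightarrow> - x \<in> F"
  using diff_in[of 0 x] by simp

lemma add_in: "x \<in> F \<Longrightarrow> y \<in> F \<Longrightarrow> x + y \<in> F"
  using diff_in[of x "- y"] minus_in by simp

lemma sum_in: "(\<And>i. i \<in> I \<Longrightarrow> f i \<in> F) \<Longrightarrow> sum f I \<in> F"
  by (induction I rule: infinite_finite_induct) (auto intro: add_in)

lemma prod_in: "(\<And>i. i \<in> I \<Longrightarrow> f i \<in> F) \<Longrightarrow> prod f I \<in> F"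
  by (induction I rule: infinite_finite_induct) (auto intro: mult_in)

lemma power_in: "x \<in> F \<Longrightarrow> x ^ n \<in> F"
  by (induction n) (auto intro: mult_in)

end

lemma subfield_set_class_ring:
  fixes F :: "'a::field set"
  assumes "subfield F class_ring" shows "subfield_set F"
proof
  have "Ring.ring (class_ring :: 'a ring)"
    using field.axioms(1)[OF class_field[where 'a='a]] by (simp add: domain_def cring_def)
  note m_inv = ring.subfield_m_inv(1)[OF this assms]
  note S = subringE[OF subfieldE(1)[OF assms]]
  show "1 \<in> F" using S(3) by simp
  show m: "x * y \<in> F" if "x \<in> F" "y \<in> F" for x y using S(6) that by simp
  show "x - y \<in> F" if "x \<in> F" "y \<in> F" for x y
    using S(5)[of y] S(7)[of x "- y"] that by (simp add: class_ring_simps)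
  show "inverse x \<in> F" if "x \<in> F" for x
  proof (cases "x = 0")
    case False
    then show ?thesis
      using m_inv[of x] that
      by (simp add: class_ring_simps)
  qed (use that in simp)
qed

lemma index_mult_mat_sum:
  "A \<in> carrier_mat n m \<Longrightarrow> B \<in> carrier_mat m k \<Longrightarrow> i < n \<Longrightarrow> j < k \<Longrightarrow>
    (A * B) $$ (i, j) = (\<Sum>l<m. A $$ (i, l) * B $$ (l, j))"
  by (auto simp: scalar_prod_def lessThan_atLeast0 intro!: sum.cong)

lemma limitin_pullback_topology:
  "limitin (pullback_topology A f X) g l F \<longleftrightarrow>
    l \<in> A \<and> eventually (\<lambda>x. g x \<in> A) F \<and> limitin X (\<lambda>x. f (g x)) (f l) F" (is "?L \<longleftrightarrow> ?R")
proof
  assume L: ?L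
  have "eventually (\<lambda>x. g x \<in> topspace (pullback_topology A f X)) F"
    using L by (auto simp: limitin_def)
  then have "eventually (\<lambda>x. g x \<in> A) F"
    by eventually_elim (simp add: topspace_pullback_topology)
  moreover have "eventually (\<lambda>x. f (g x) \<in> U) F" if "openin X U" "f l \<in> U" for U
  proof -
    have "openin (pullback_topology A f X) (f -` U \<inter> A)" "l \<in> f -` U \<inter> A"
      using that L by (auto simp: openin_pullback_topology limitin_def topspace_pullback_topology)
    from limitinD[OF L this] show ?thesis by eventually_elim simp
  qed
  ultimately show ?R using L by (auto simp: limitin_def topspace_pullback_topology)
next
  assume R: ?R
  then show ?L
    by (auto simp: limitin_def topspace_pullback_topology openin_pullback_topology
        intro!: eventually_conj)
qed

text \<open>The ambient space of all square matrices over the local field; limits of matrices over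
  \<open>F\<close> may have entries outside \<open>F\<close> and are taken here.\<close>

definition mat_topology :: "nat \<Rightarrow> 'a topology \<Rightarrow> 'a mat topology" where
  "mat_topology n T = pullback_topology (carrier_mat n n)
     (\<lambda>A. restrict (\<lambda>ij. A $$ ij) ({..<n} \<times> {..<n})) (product_topology (\<lambda>_. T) ({..<n} \<times> {..<n}))"

lemma SL_topology_eq_subtopology:
  "SL_topology n F T = subtopology (mat_topology n T) (carrier (SL n F))"
proof -
  let ?f = "\<lambda>A::'a mat. restrict (\<lambda>ij. A $$ ij) ({..<n} \<times> {..<n})"
  let ?P = "product_topology (\<lambda>_. T) ({..<n} \<times> {..<n})"
  have f: "?f A \<in> Pi\<^sub>E ({..<n} \<times> {..<n}) (\<lambda>_. F)" if "A \<in> carrier (SL n F)" for A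
    using that by (auto simp: SL_def)
  have *: "product_topology (\<lambda>_. subtopology T F) ({..<n} \<times> {..<n}) =
      subtopology ?P (Pi\<^sub>E ({..<n} \<times> {..<n}) (\<lambda>_. F))"
    by (rule subtopology_product_topology[symmetric])
  have c: "carrier (SL n F) \<subseteq> carrier_mat n n" by (auto simp: SL_def)
  have "openin (SL_topology n F T) S \<longleftrightarrow> openin (subtopology (mat_topology n T) (carrier (SL n F))) S" for S
  proof
    assume "openin (SL_topology n F T) S"
    then obtain U where U: "openin ?P U"
      "S = ?f -` (U \<inter> Pi\<^sub>E ({..<n} \<times> {..<n}) (\<lambda>_. F)) \<inter> carrier (SL n F)"
      by (auto simp: SL_topology_def openin_pullback_topology * openin_subtopology)
    then have "S = (?f -` U \<inter> carrier_mat n n) \<inter> carrier (SL n F)" using f c by auto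
    then show "openin (subtopology (mat_topology n T) (carrier (SL n F))) S"
      unfolding openin_subtopology mat_topology_def openin_pullback_topology using U(1) by blast
  next
    assume "openin (subtopology (mat_topology n T) (carrier (SL n F))) S"
    then obtain U where U: "openin ?P U" "S = (?f -` U \<inter> carrier_mat n n) \<inter> carrier (SL n F)"
      by (auto simp: mat_topology_def openin_pullback_topology openin_subtopology)
    then have "S = ?f -` (U \<inter> Pi\<^sub>E ({..<n} \<times> {..<n}) (\<lambda>_. F)) \<inter> carrier (SL n F)"
      using f c by auto
    then show "openin (SL_topology n F T) S"
      unfolding openin_subtopology SL_topology_def * openin_pullback_topology using U(1) by blast
  qed
  then show ?thesis by (simp add: topology_eq)
qed

lemma carrier_SL: "A \<in> carrier (SL n F) \<longleftrightarrow>
    A \<in> carrier_mat n n \<and> (\<forall>i<n. \<forall>j<n. A $$ (i, j) \<in> F) \<and> det A = 1"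
  by (auto simp: SL_def)

lemma SL_simps [simp]: "x \<otimes>\<^bsub>SL n F\<^esub> y = x * y" "\<one>\<^bsub>SL n F\<^esub> = 1\<^sub>m n"
  by (simp_all add: SL_def)

text \<open>For determinant 1 the adjugate is the inverse. Its entries are polynomials in those of
  \<open>A\<close>, so it is continuous and stays over \<open>F\<close>; this is why it serves as
  the inverse throughout.\<close>

lemma adj_mat_SL:
  assumes "A \<in> carrier_mat n n" "det A = 1"
  shows "adj_mat A \<in> carrier_mat n n" "A * adj_mat A = 1\<^sub>m n" "adj_mat A * A = 1\<^sub>m n" "det (adj_mat A) = 1"
proof -
  show c: "adj_mat A \<in> carrier_mat n n" and m: "A * adj_mat A = 1\<^sub>m n" "adj_mat A * A = 1\<^sub>m n"
    using adj_mat[OF assms(1)] assms(2) by (auto intro!: eq_matI)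
  then show "det (adj_mat A) = 1" using det_mult[OF assms(1) c] assms(2) by simp
qed

lemma adj_mat_unique:
  assumes "A \<in> carrier_mat n n" "B \<in> carrier_mat n n" "det A = 1" "A * B = 1\<^sub>m n"
  shows "adj_mat A = B"
proof -
  note adj = adj_mat_SL[OF assms(1,3)]
  have "adj_mat A = adj_mat A * (A * B)" unfolding assms(4) using adj(1) by simp
  also have "\<dots> = adj_mat A * A * B" using assms(1,2) adj(1) by (intro assoc_mult_mat[symmetric])
  also have "\<dots> = B" unfolding adj(3) using assms(2) by simp
  finally show ?thesis .
qed

context subfield_set
begin

lemma det_in:
  assumes "A \<in> carrier_mat n n" "\<forall>i<n. \<forall>j<n. A $$ (i, j) \<in> F"
  shows "det A \<in> F"
  unfolding det_def'[OF assms(1)]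
proof (intro sum_in mult_in prod_in)
  fix p assume "p \<in> {p. p permutes {0..<n}}"
  then show "A $$ (i, p i) \<in> F" if "i \<in> {0..<n}" for i
    using assms(2) that permutes_in_image[of p "{0..<n}" i] by auto
  show "signof p \<in> F" by (auto simp: sign_def minus_in)
qed

lemma adj_mat_in:
  assumes A: "A \<in> carrier_mat n n" "\<forall>i<n. \<forall>j<n. A $$ (i, j) \<in> F" and ij: "i < n" "j < n"
  shows "adj_mat A $$ (i, j) \<in> F"
proof -
  have "mat_delete A j i \<in> carrier_mat (n - 1) (n - 1)" by (rule mat_delete_carrier[OF A(1)])
  moreover have "mat_delete A j i $$ (k, l) \<in> F" if "k < n - 1" "l < n - 1" for k l
    using A that by (auto simp: mat_delete_def)
  ultimately have "det (mat_delete A j i) \<in> F" by (intro det_in) auto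
  then show ?thesis
    using A(1) ij by (auto simp: adj_mat_def cofactor_def intro!: mult_in power_in minus_in)
qed

lemma mult_mat_in:
  assumes "A \<in> carrier_mat n n" "B \<in> carrier_mat n n" "\<forall>i<n. \<forall>j<n. A $$ (i, j) \<in> F"
    "\<forall>i<n. \<forall>j<n. B $$ (i, j) \<in> F" "i < n" "j < n"
  shows "(A * B) $$ (i, j) \<in> F"
  using assms by (auto simp: index_mult_mat_sum simp del: index_mult_mat intro!: sum_in mult_in)

lemma group_SL: "group (SL n F)"
proof (rule groupI)
  fix x y assume "x \<in> carrier (SL n F)" "y \<in> carrier (SL n F)"
  then show "x \<otimes>\<^bsub>SL n F\<^esub> y \<in> carrier (SL n F)"
    by (auto simp: carrier_SL det_mult simp del: index_mult_mat intro!: mult_mat_in)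
next
  fix x assume "x \<in> carrier (SL n F)"
  then show "\<exists>y\<in>carrier (SL n F). y \<otimes>\<^bsub>SL n F\<^esub> x = \<one>\<^bsub>SL n F\<^esub>"
    using adj_mat_SL[of x n] adj_mat_in[of x n] by (intro bexI[of _ "adj_mat x"]) (auto simp: carrier_SL)
qed (auto simp: carrier_SL intro: assoc_mult_mat)

lemma inv_SL:
  assumes "A \<in> carrier (SL n F)" shows "inv\<^bsub>SL n F\<^esub> A = adj_mat A"
proof -
  interpret group "SL n F" by (rule group_SL)
  show ?thesis
    using assms adj_mat_SL[of A n] adj_mat_in[of A n]
    by (intro inv_equality) (auto simp: carrier_SL)
qed

lemma adj_mat_carrier_SL: "A \<in> carrier (SL n F) \<Longrightarrow> adj_mat A \<in> carrier (SL n F)"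
  using group.inv_closed[OF group_SL] inv_SL by metis

lemma mult_carrier_SL: "A \<in> carrier (SL n F) \<Longrightarrow> B \<in> carrier (SL n F) \<Longrightarrow> A * B \<in> carrier (SL n F)"
  using group.is_monoid[OF group_SL, of n] monoid.m_closed[of "SL n F" A B] by simp

lemma addrow_mat_carrier_SL:
  "x \<in> F \<Longrightarrow> i \<noteq> j \<Longrightarrow> addrow_mat n x i j \<in> carrier (SL n F)"
  by (auto simp: carrier_SL det_addrow_mat intro!: add_in)

end

section \<open>Continuity of the matrix operations\<close>

context top_field
begin

lemma topspace_mat_topology: "topspace (mat_topology n T) = carrier_mat n n"
  by (auto simp: mat_topology_def topspace_pullback_topology)

lemma limitin_mat_topology:
  "limitin (mat_topology n T) g A F \<longleftrightarrow> A \<in> carrier_mat n n \<and>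
    eventually (\<lambda>x. g x \<in> carrier_mat n n) F \<and>
    (\<forall>i<n. \<forall>j<n. limitin T (\<lambda>x. g x $$ (i, j)) (A $$ (i, j)) F)"
  by (auto simp: mat_topology_def limitin_pullback_topology limitin_componentwise)

lemma Hausdorff_mat_topology: "Hausdorff_space (mat_topology n T)"
proof (rule Hausdorff_space_injective_preimage)
  let ?f = "\<lambda>A::'a mat. restrict (\<lambda>ij. A $$ ij) ({..<n} \<times> {..<n})"
  show "Hausdorff_space (product_topology (\<lambda>_. T) ({..<n} \<times> {..<n}))"
    using Hausdorff by (simp add: Hausdorff_space_product_topology)
  show "continuous_map (mat_topology n T) (product_topology (\<lambda>_. T) ({..<n} \<times> {..<n})) ?f"
    unfolding mat_topology_def
    using continuous_map_pullback[OF continuous_map_id, of "carrier_mat n n" ?f] by (simp add: o_def)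
  show "inj_on ?f (topspace (mat_topology n T))"
  proof (rule inj_onI)
    fix A B assume AB: "A \<in> topspace (mat_topology n T)" "B \<in> topspace (mat_topology n T)" "?f A = ?f B"
    have "A $$ (i, j) = B $$ (i, j)" if "i < n" "j < n" for i j
      using fun_cong[OF AB(3), of "(i, j)"] that by simp
    then show "A = B" using AB(1,2) by (intro eq_matI) (auto simp: topspace_mat_topology)
  qed
qed

lemma lim_mat_mult:
  assumes "limitin (mat_topology n T) g A F" "limitin (mat_topology n T) h B F"
  shows "limitin (mat_topology n T) (\<lambda>x. g x * h x) (A * B) F"
  unfolding limitin_mat_topology
proof (intro conjI allI impI)
  have c: "eventually (\<lambda>x. g x \<in> carrier_mat n n) F" "eventually (\<lambda>x. h x \<in> carrier_mat n n) F"
    "A \<in> carrier_mat n n" "B \<in> carrier_mat n n"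
    using assms by (auto simp: limitin_mat_topology)
  show "A * B \<in> carrier_mat n n" using c by auto
  show "eventually (\<lambda>x. g x * h x \<in> carrier_mat n n) F"
    using c(1,2) by eventually_elim auto
  fix i j assume ij: "i < n" "j < n"
  have "limitin T (\<lambda>x. \<Sum>l<n. g x $$ (i, l) * h x $$ (l, j)) (\<Sum>l<n. A $$ (i, l) * B $$ (l, j)) F"
    using assms ij by (intro lim_sum lim_mult) (auto simp: limitin_mat_topology)
  moreover have "eventually (\<lambda>x. (\<Sum>l<n. g x $$ (i, l) * h x $$ (l, j)) = (g x * h x) $$ (i, j)) F"
    using c(1,2) by eventually_elim (use ij in \<open>simp add: index_mult_mat_sum del: index_mult_mat\<close>)
  ultimately show "limitin T (\<lambda>x. (g x * h x) $$ (i, j)) ((A * B) $$ (i, j)) F"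
    using c(3,4) ij by (auto simp: index_mult_mat_sum simp del: index_mult_mat
        intro: limitin_transform_eventually)
qed

lemma lim_det:
  assumes "limitin (mat_topology n T) g A F"
  shows "limitin T (\<lambda>x. det (g x)) (det A) F"
proof -
  have c: "eventually (\<lambda>x. g x \<in> carrier_mat n n) F" "A \<in> carrier_mat n n"
    using assms by (auto simp: limitin_mat_topology)
  have "limitin T (\<lambda>x. \<Sum>p\<in>{p. p permutes {0..<n}}. signof p * (\<Prod>i=0..<n. g x $$ (i, p i)))
    (\<Sum>p\<in>{p. p permutes {0..<n}}. signof p * (\<Prod>i=0..<n. A $$ (i, p i))) F"
  proof (intro lim_sum lim_mult lim_prod lim_const)
    fix p i assume "p \<in> {p. p permutes {0..<n}}" "i \<in> {0..<n}"
    then show "limitin T (\<lambda>x. g x $$ (i, p i)) (A $$ (i, p i)) F"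
      using assms permutes_in_image[of p "{0..<n}" i] by (auto simp: limitin_mat_topology)
  qed
  moreover have "eventually (\<lambda>x. (\<Sum>p\<in>{p. p permutes {0..<n}}. signof p * (\<Prod>i=0..<n. g x $$ (i, p i)))
      = det (g x)) F"
    using c(1) by eventually_elim (simp add: det_def')
  ultimately show ?thesis
    using c(2) by (auto simp: det_def' intro: limitin_transform_eventually)
qed

lemma lim_adj_mat:
  assumes g: "limitin (mat_topology n T) g A F"
  shows "limitin (mat_topology n T) (\<lambda>x. adj_mat (g x)) (adj_mat A) F"
  unfolding limitin_mat_topology
proof (intro conjI allI impI)
  have c: "eventually (\<lambda>x. g x \<in> carrier_mat n n) F" "A \<in> carrier_mat n n"
    using assms by (auto simp: limitin_mat_topology)
  show "adj_mat A \<in> carrier_mat n n" using c adj_mat by auto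
  show "eventually (\<lambda>x. adj_mat (g x) \<in> carrier_mat n n) F"
    using c(1) by eventually_elim (use adj_mat in auto)
  fix i j assume ij: "i < n" "j < n"
  have "limitin (mat_topology (n - 1) T) (\<lambda>x. mat_delete (g x) j i) (mat_delete A j i) F"
    unfolding limitin_mat_topology
  proof (intro conjI allI impI)
    show "mat_delete A j i \<in> carrier_mat (n - 1) (n - 1)" by (rule mat_delete_carrier[OF c(2)])
    show "eventually (\<lambda>x. mat_delete (g x) j i \<in> carrier_mat (n - 1) (n - 1)) F"
      using c(1) by eventually_elim (rule mat_delete_carrier)
    fix k l assume kl: "k < n - 1" "l < n - 1"
    \<comment> \<open>Indices in the full matrix, shifted past the deleted row \<open>j\<close> and
      column \<open>i\<close>.\<close>
    let ?k = "if k < j then k else Suc k" and ?l = "if l < i then l else Suc l"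
    have "eventually (\<lambda>x. g x $$ (?k, ?l) = mat_delete (g x) j i $$ (k, l)) F"
      using c(1) by eventually_elim (use kl in \<open>auto simp: mat_delete_def\<close>)
    moreover have "?k < n" "?l < n" using kl by auto
    then have "limitin T (\<lambda>x. g x $$ (?k, ?l)) (A $$ (?k, ?l)) F"
      using g unfolding limitin_mat_topology by blast
    ultimately have "limitin T (\<lambda>x. mat_delete (g x) j i $$ (k, l)) (A $$ (?k, ?l)) F"
      by (rule limitin_transform_eventually)
    then show "limitin T (\<lambda>x. mat_delete (g x) j i $$ (k, l)) (mat_delete A j i $$ (k, l)) F"
      using c(2) kl by (simp add: mat_delete_def)
  qed
  then have "limitin T (\<lambda>x. (- 1) ^ (j + i) * det (mat_delete (g x) j i)) ((- 1) ^ (j + i) * det (mat_delete A j i)) F"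
    by (intro lim_mult lim_const lim_det)
  moreover have "eventually (\<lambda>x. (- 1) ^ (j + i) * det (mat_delete (g x) j i) = adj_mat (g x) $$ (i, j)) F"
    using c(1) by eventually_elim (use ij in \<open>auto simp: adj_mat_def cofactor_def\<close>)
  ultimately show "limitin T (\<lambda>x. adj_mat (g x) $$ (i, j)) (adj_mat A $$ (i, j)) F"
    using c(2) ij by (auto simp: adj_mat_def cofactor_def intro: limitin_transform_eventually)
qed

lemma limitin_SL_topology:
  "limitin (SL_topology n S T) g A F \<longleftrightarrow> A \<in> carrier (SL n S) \<and>
    eventually (\<lambda>x. g x \<in> carrier (SL n S)) F \<and> limitin (mat_topology n T) g A F"
  by (simp add: SL_topology_eq_subtopology limitin_subtopology)

lemma topological_group_SL:
  assumes "subfield_set S"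
  shows "topological_group (SL n S) (SL_topology n S T)"
proof -
  interpret subfield_set S by fact
  let ?X = "SL_topology n S T"
  have ts: "topspace ?X = carrier (SL n S)" by (simp add: topspace_SL_topology)
  have "continuous_map (prod_topology ?X ?X) ?X (\<lambda>(x, y). x * y)"
    unfolding continuous_map_atin
  proof
    fix p assume p: "p \<in> topspace (prod_topology ?X ?X)"
    let ?A = "atin (prod_topology ?X ?X) p"
    have 1: "limitin ?X fst (fst p) ?A" and 2: "limitin ?X snd (snd p) ?A"
      using p by (auto intro!: limitin_continuous_map continuous_map_fst continuous_map_snd)
    have "eventually (\<lambda>x. fst x * snd x \<in> carrier (SL n S)) ?A"
      using 1 2 eventually_elim2[of "\<lambda>x. fst x \<in> carrier (SL n S)" ?A "\<lambda>x. snd x \<in> carrier (SL n S)"]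
      by (auto simp: limitin_SL_topology mult_carrier_SL)
    then show "limitin ?X (\<lambda>(x, y). x * y) ((\<lambda>(x, y). x * y) p) ?A"
      using 1 2 by (auto simp: limitin_SL_topology case_prod_unfold mult_carrier_SL lim_mat_mult)
  qed
  moreover have "continuous_map ?X ?X (\<lambda>x. inv\<^bsub>SL n S\<^esub> x)"
  proof (rule continuous_map_eq)
    show "continuous_map ?X ?X adj_mat"
      unfolding continuous_map_atin
    proof
      fix A assume A: "A \<in> topspace ?X"
      then have 1: "limitin ?X (\<lambda>x. x) A (atin ?X A)" by (auto intro!: limitin_continuous_map)
      then show "limitin ?X adj_mat (adj_mat A) (atin ?X A)"
        using eventually_mono[of "\<lambda>x. x \<in> carrier (SL n S)" "atin ?X A"] lim_adj_mat
        by (auto simp: limitin_SL_topology adj_mat_carrier_SL)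
    qed
  qed (simp add: ts inv_SL)
  moreover have "Hausdorff_space ?X"
    by (simp add: SL_topology_eq_subtopology Hausdorff_mat_topology Hausdorff_space_subtopology)
  ultimately show ?thesis
    by (simp add: topological_group_def group_SL ts case_prod_unfold)
qed

end

section \<open>Squeezing commutators into elementary matrices\<close>

text \<open>The product is the \<open>(i, j)\<close> entry of the matrix unit at
  \<open>(p, q)\<close> conjugated by \<open>A\<close>, compared with that unit itself. If
  conjugation never changes an off-diagonal entry of an off-diagonal unit, then \<open>A\<close>
  must be scalar.\<close>

lemma nonscalar_witness:
  fixes A :: "'a::field mat"
  assumes n: "2 \<le> n" and c: "A \<in> carrier_mat n n" "B \<in> carrier_mat n n" and AB: "A * B = 1\<^sub>m n"
    and nonscalar: "\<And>c. A \<noteq> c \<cdot>\<^sub>m 1\<^sub>m n"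
  obtains p q i j where "p < n" "q < n" "i < n" "j < n" "p \<noteq> q" "i \<noteq> j"
    "A $$ (i, p) * B $$ (q, j) \<noteq> (if i = p \<and> j = q then 1 else 0)"
proof (rule ccontr)
  assume no: "\<not> thesis"
  note witness = that
  have eq: "A $$ (i, p) * B $$ (q, j) = (if i = p \<and> j = q then 1 else 0)"
    if "p < n" "q < n" "i < n" "j < n" "p \<noteq> q" "i \<noteq> j" for p q i j
    using no witness[OF that] by blast
  have diag: "A $$ (p, p) * B $$ (q, q) = 1" if "p < n" "q < n" "p \<noteq> q" for p q
    using eq[of p q p q] that by simp
  have AB_sum: "(\<Sum>l<n. A $$ (i, l) * B $$ (l, j)) = (if i = j then 1 else 0)" if "i < n" "j < n" for i j
    using AB index_mult_mat_sum[OF c that] that by simp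
  have off: "A $$ (i, p) = 0" if ip: "i < n" "p < n" "i \<noteq> p" for i p
  proof (cases "\<exists>q<n. q \<noteq> p \<and> q \<noteq> i")
    case True
    then obtain q where q: "q < n" "q \<noteq> p" "q \<noteq> i" by blast
    then show ?thesis using eq[of p q i q] diag[of p q] ip by auto
  next
    \<comment> \<open>No third index exists, so \<open>n = 2\<close>. Entry \<open>(i, p)\<close> of
      \<open>A * B = 1\<^sub>m n\<close> then has just two summands, which replaces the comparison
      with a third index.\<close>
    case False
    then have "{..<n} = {i, p}" using ip by auto
    then have "A $$ (i, i) * B $$ (i, p) + A $$ (i, p) * B $$ (p, p) = 0"
      using AB_sum[of i p] ip by simp
    moreover have "A $$ (i, p) * B $$ (i, p) = 0" using eq[of p i i p] ip by simp
    moreover have "B $$ (p, p) \<noteq> 0" using diag[of i p] ip by auto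
    ultimately show ?thesis by auto
  qed
  have "A $$ (q, q) = A $$ (0, 0)" if q: "q < n" for q
  proof (cases "q = 0")
    case False
    have "(\<Sum>l<n. A $$ (q, l) * B $$ (l, q)) = A $$ (q, q) * B $$ (q, q)"
      using q off by (subst sum.remove[of _ q]) (auto intro!: sum.neutral)
    then have "A $$ (q, q) * B $$ (q, q) = 1" using AB_sum[OF q q] by simp
    moreover have "A $$ (0, 0) * B $$ (q, q) = 1" using diag[of 0 q] q False by simp
    ultimately show ?thesis by (metis mult_cancel_right mult_zero_right zero_neq_one)
  qed simp
  then have diag_eq: "\<And>q. q < n \<Longrightarrow> A $$ (q, q) = A $$ (0, 0)" by blast
  have "A = A $$ (0, 0) \<cdot>\<^sub>m 1\<^sub>m n"
  proof (rule eq_matI)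
    fix a b assume "a < dim_row (A $$ (0, 0) \<cdot>\<^sub>m 1\<^sub>m n)" "b < dim_col (A $$ (0, 0) \<cdot>\<^sub>m 1\<^sub>m n)"
    then show "A $$ (a, b) = (A $$ (0, 0) \<cdot>\<^sub>m 1\<^sub>m n) $$ (a, b)"
      using off[of a b] diag_eq[of a] by (cases "a = b") auto
  qed (use c in auto)
  then show False using nonscalar by blast
qed

section \<open>Torus elements, elementary matrices and their commutators\<close>

definition torus_mat :: "nat \<Rightarrow> nat \<Rightarrow> nat \<Rightarrow> 'a::field \<Rightarrow> 'a mat" where
  "torus_mat n i j t = mat n n
     (\<lambda>(a, b). if a = b then if a = i then inverse t else if a = j then t else 1 else 0)"

lemma torus_mat_carrier [simp]: "torus_mat n i j t \<in> carrier_mat n n"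
  by (simp add: torus_mat_def)

lemma mult_torus_mat_left:
  assumes "X \<in> carrier_mat n n" "a < n" "b < n"
  shows "(torus_mat n i j t * X) $$ (a, b) = (if a = i then inverse t else if a = j then t else 1) * X $$ (a, b)"
proof -
  have "(torus_mat n i j t * X) $$ (a, b) = (\<Sum>l<n. torus_mat n i j t $$ (a, l) * X $$ (l, b))"
    using assms by (intro index_mult_mat_sum) auto
  also have "\<dots> = torus_mat n i j t $$ (a, a) * X $$ (a, b)"
    using assms by (subst sum.remove[of _ a]) (auto simp: torus_mat_def intro!: sum.neutral)
  finally show ?thesis using assms by (auto simp: torus_mat_def)
qed

lemma mult_torus_mat_right:
  assumes "X \<in> carrier_mat n n" "a < n" "b < n"
  shows "(X * torus_mat n i j t) $$ (a, b) = X $$ (a, b) * (if b = i then inverse t else if b = j then t else 1)"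
proof -
  have "(X * torus_mat n i j t) $$ (a, b) = (\<Sum>l<n. X $$ (a, l) * torus_mat n i j t $$ (l, b))"
    using assms by (intro index_mult_mat_sum) auto
  also have "\<dots> = X $$ (a, b) * torus_mat n i j t $$ (b, b)"
    using assms by (subst sum.remove[of _ b]) (auto simp: torus_mat_def intro!: sum.neutral)
  finally show ?thesis using assms by (auto simp: torus_mat_def)
qed

lemma det_torus_mat:
  assumes "i < n" "j < n" "i \<noteq> j" "t \<noteq> 0" shows "det (torus_mat n i j t) = 1"
proof -
  have "det (torus_mat n i j t) = (\<Prod>a\<in>{0..<n}. if a = i then inverse t else if a = j then t else 1)"
    by (subst det_upper_triangular[of _ n])
      (auto simp: prod_list_diag_prod torus_mat_def upper_triangular_def)
  also have "\<dots> = (\<Prod>a\<in>{0..<n}. (if a = i then inverse t else 1) * (if a = j then t else 1))"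
    using assms by (intro prod.cong) auto
  also have "\<dots> = 1" using assms by (simp add: prod.distrib)
  finally show ?thesis .
qed

lemma adj_mat_torus_mat:
  assumes "i < n" "j < n" "i \<noteq> j" "t \<noteq> 0"
  shows "adj_mat (torus_mat n i j t) = torus_mat n i j (inverse t)"
proof (rule adj_mat_unique)
  show "torus_mat n i j t * torus_mat n i j (inverse t) = 1\<^sub>m n"
    using assms by (intro eq_matI) (auto simp: mult_torus_mat_left simp del: index_mult_mat, auto simp: torus_mat_def)
qed (use assms in \<open>auto simp: det_torus_mat\<close>)

lemma adj_mat_addrow_mat:
  fixes x :: "'a::field"
  assumes "i < n" "j < n" "i \<noteq> j"
  shows "adj_mat (addrow_mat n x i j) = addrow_mat n (- x) i j"
  using assms by (intro adj_mat_unique) (auto simp: det_addrow_mat addrow_mat_inv)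

text \<open>An elementary matrix is the identity plus \<open>x\<close> times a matrix unit, so
  inserting it perturbs the product \<open>A * Y\<close> by a matrix of rank at most one. Both the
  commutator formula and the conjugation of elementary matrices by unbounded \<open>g\<close> rest
  on this.\<close>

lemma mult_addrow_mat_mult:
  fixes A Y :: "'a::field mat"
  assumes A: "A \<in> carrier_mat n n" and Y: "Y \<in> carrier_mat n n"
    and pq: "p < n" "q < n" and ab: "a < n" "b < n"
  shows "(A * (addrow_mat n x p q * Y)) $$ (a, b) = (A * Y) $$ (a, b) + x * A $$ (a, p) * Y $$ (q, b)"
proof -
  have "(A * (addrow_mat n x p q * Y)) $$ (a, b) = (\<Sum>l<n. A $$ (a, l) * (addrow_mat n x p q * Y) $$ (l, b))"
    using A Y ab by (intro index_mult_mat_sum) auto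
  also have "\<dots> = (\<Sum>l<n. A $$ (a, l) * Y $$ (l, b) + (if l = p then x * A $$ (a, p) * Y $$ (q, b) else 0))"
    using Y ab pq by (intro sum.cong) (auto simp: addrow_mat[symmetric] algebra_simps simp del: index_mult_mat)
  also have "\<dots> = (A * Y) $$ (a, b) + x * A $$ (a, p) * Y $$ (q, b)"
    using pq index_mult_mat_sum[OF A Y ab] by (simp add: sum.distrib del: index_mult_mat)
  finally show ?thesis .
qed

lemma addrow_commutator:
  fixes A B :: "'a::field mat"
  assumes c: "A \<in> carrier_mat n n" "B \<in> carrier_mat n n" and AB: "A * B = 1\<^sub>m n"
    and pq: "p < n" "q < n" "p \<noteq> q" and ab: "a < n" "b < n"
  shows "(A * (addrow_mat n x p q * (B * addrow_mat n (- x) p q))) $$ (a, b) =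
    (if a = b then 1 else 0) - (if a = p \<and> b = q then x else 0)
      + x * A $$ (a, p) * (B $$ (q, b) - (if b = q then x * B $$ (q, p) else 0))"
proof -
  let ?u = "addrow_mat n (- x) p q"
  define Y where "Y = B * ?u"
  have Yc: "Y \<in> carrier_mat n n" using c by (simp add: Y_def)
  have Y: "Y = addcol (- x) q p B" unfolding Y_def by (rule addcol_mat[symmetric]) (use c pq in auto)
  have "A * Y = A * B * ?u" unfolding Y_def using c by (intro assoc_mult_mat[symmetric]) auto
  then have AY: "A * Y = ?u" using AB by simp
  have "(A * (addrow_mat n x p q * Y)) $$ (a, b) = (A * Y) $$ (a, b) + x * A $$ (a, p) * Y $$ (q, b)"
    using c Yc pq ab by (intro mult_addrow_mat_mult)
  also have "Y $$ (q, b) = B $$ (q, b) - (if b = q then x * B $$ (q, p) else 0)"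
    using c pq ab by (auto simp: Y mat_addcol_def)
  also have "(A * Y) $$ (a, b) = (if a = b then 1 else 0) - (if a = p \<and> b = q then x else 0)"
    using pq ab by (auto simp: AY)
  finally show ?thesis unfolding Y_def .
qed

text \<open>The factor \<open>t\<^sup>2\<close> in the elementary matrix is what torus conjugation
  divides out again at \<open>(i, j)\<close>, so that \<open>y\<close> survives as a free parameter
  in the limit at \<open>t = 0\<close>.\<close>

definition squeezed_commutator :: "nat \<Rightarrow> nat \<Rightarrow> nat \<Rightarrow> nat \<Rightarrow> nat \<Rightarrow> 'a::field mat \<Rightarrow> 'a \<Rightarrow> 'a \<Rightarrow> 'a mat" where
  "squeezed_commutator n p q i j A y t =
     torus_mat n i j t *
       (A * (addrow_mat n (y * t\<^sup>2) p q * (adj_mat A * adj_mat (addrow_mat n (y * t\<^sup>2) p q))))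
     * adj_mat (torus_mat n i j t)"

text \<open>One factor \<open>t\<close> of \<open>t\<^sup>2\<close> is given to the row scaling and
  one to the column scaling. This clears every \<open>inverse t\<close>, and the right-hand side is
  a polynomial in \<open>t\<close> that can be evaluated at zero.\<close>

lemma squeezed_commutator_index:
  assumes A: "A \<in> carrier_mat n n" "det A = 1"
    and pq: "p < n" "q < n" "p \<noteq> q" and ij: "i < n" "j < n" "i \<noteq> j" and ab: "a < n" "b < n" and t: "t \<noteq> 0"
  shows "squeezed_commutator n p q i j A y t $$ (a, b) = (if a = b then 1 else 0) +
    (if a = i then 1 else if a = j then t\<^sup>2 else t) * (if b = i then t\<^sup>2 else if b = j then 1 else t) *
    (y * A $$ (a, p) * (adj_mat A $$ (q, b) - (if b = q then y * t\<^sup>2 * adj_mat A $$ (q, p) else 0))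
      - (if a = p \<and> b = q then y else 0))"
proof -
  let ?d = "if a = i then inverse t else if a = j then t else 1"
  let ?e = "if b = i then t else if b = j then inverse t else 1"
  let ?\<delta> = "if a = b then 1 else 0 :: 'a"
  let ?m = "if a = i then 1 else if a = j then t\<^sup>2 else t"
  let ?m' = "if b = i then t\<^sup>2 else if b = j then 1 else t"
  let ?R = "y * A $$ (a, p) * (adj_mat A $$ (q, b) - (if b = q then y * t\<^sup>2 * adj_mat A $$ (q, p) else 0))
      - (if a = p \<and> b = q then y else 0)"
  note adj = adj_mat_SL[OF A]
  define C where "C = A * (addrow_mat n (y * t\<^sup>2) p q * (adj_mat A * addrow_mat n (- (y * t\<^sup>2)) p q))"
  have C: "C \<in> carrier_mat n n" unfolding C_def using A adj by (intro mult_carrier_mat[of _ n n]) auto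
  have s: "squeezed_commutator n p q i j A y t = torus_mat n i j t * C * torus_mat n i j (inverse t)"
    unfolding squeezed_commutator_def C_def using pq ij t by (simp add: adj_mat_torus_mat adj_mat_addrow_mat)
  have "squeezed_commutator n p q i j A y t $$ (a, b) =
      (if a = i then inverse t else if a = j then t else 1) * C $$ (a, b) *
      (if b = i then t else if b = j then inverse t else 1)"
    unfolding s using C ab t
    by (subst mult_torus_mat_right)
      (auto simp: mult_torus_mat_left simp del: index_mult_mat intro!: mult_carrier_mat[of _ n n])
  also have "C $$ (a, b) = (if a = b then 1 else 0) + t\<^sup>2 *
    (y * A $$ (a, p) * (adj_mat A $$ (q, b) - (if b = q then y * t\<^sup>2 * adj_mat A $$ (q, p) else 0))
      - (if a = p \<and> b = q then y else 0))"
    unfolding C_def addrow_commutator[OF A(1) adj(1,2) pq ab]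
    by (cases "b = q"; cases "a = p") (simp_all add: algebra_simps)
  finally have eq: "squeezed_commutator n p q i j A y t $$ (a, b) = ?d * (?\<delta> + t\<^sup>2 * ?R) * ?e" .
  have distrib: "d * (\<delta> + s * R) * e = \<delta> + m * R"
    if "\<delta> * (d * e) = \<delta>" "d * s * e = m" for d e \<delta> R s m :: 'a
  proof -
    have "d * (\<delta> + s * R) * e = \<delta> * (d * e) + d * s * e * R" by (simp add: algebra_simps)
    then show ?thesis unfolding that .
  qed
  show ?thesis
    unfolding eq
  proof (rule distrib)
    show "?\<delta> * (?d * ?e) = ?\<delta>" using t ij by auto
    have "inverse t * (t * t) * inverse t = 1" using t by (simp add: field_simps)
    then show "?d * t\<^sup>2 * ?e = ?m * ?m'" using t ij by (cases "a = i"; cases "a = j"; cases "b = i"; cases "b = j") (simp_all add: power2_eq_square)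
  qed
qed

context top_field
begin

text \<open>Conjugating \<open>A u A\<^sup>-\<^sup>1 u\<^sup>-\<^sup>1\<close>, for \<open>u\<close> an elementary matrix at distance \<open>t\<^sup>2\<close> from the
  identity, by the torus element with entries \<open>t\<^sup>-\<^sup>1\<close> and \<open>t\<close> at \<open>i\<close> and \<open>j\<close> magnifies
  the \<open>(i, j)\<close> entry by exactly \<open>t\<^sup>-\<^sup>2\<close> and every other entry by less.\<close>

lemma lim_squeezed_commutator:
  assumes A: "A \<in> carrier_mat n n" "det A = 1"
    and pq: "p < n" "q < n" "p \<noteq> q" and ij: "i < n" "j < n" "i \<noteq> j"
  shows "limitin (mat_topology n T) (squeezed_commutator n p q i j A y)
    (addrow_mat n (y * (A $$ (i, p) * adj_mat A $$ (q, j) - (if i = p \<and> j = q then 1 else 0))) i j)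
    (atin_within T 0 S)"
  unfolding limitin_mat_topology
proof (intro conjI allI impI)
  show "addrow_mat n (y * (A $$ (i, p) * adj_mat A $$ (q, j) - (if i = p \<and> j = q then 1 else 0))) i j
    \<in> carrier_mat n n" by simp
  have "squeezed_commutator n p q i j A y t \<in> carrier_mat n n" for t
    unfolding squeezed_commutator_def using A
    by (intro mult_carrier_mat[of _ n n] adj_mat(1)) auto
  then show "eventually (\<lambda>t. squeezed_commutator n p q i j A y t \<in> carrier_mat n n) (atin_within T 0 S)"
    by simp
  fix a b assume ab: "a < n" "b < n"
  let ?m = "\<lambda>t. if a = i then 1 else if a = j then t\<^sup>2 else t"
  let ?m' = "\<lambda>t. if b = i then t\<^sup>2 else if b = j then 1 else t"
  let ?r = "\<lambda>t. y * A $$ (a, p) * (adj_mat A $$ (q, b) - (if b = q then y * t\<^sup>2 * adj_mat A $$ (q, p) else 0))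
      - (if a = p \<and> b = q then y else 0)"
  have id: "limitin T (\<lambda>t. t) 0 (atin_within T 0 S)"
    by (auto simp: limitin_def eventually_atin_within)
  have sq: "limitin T (\<lambda>t. t\<^sup>2) 0 (atin_within T 0 S)"
    using lim_power[OF id, of 2] by simp
  have m: "limitin T ?m (?m 0) (atin_within T 0 S)"
    using id sq by (cases "a = i"; cases "a = j") auto
  have m': "limitin T ?m' (?m' 0) (atin_within T 0 S)"
    using id sq by (cases "b = i"; cases "b = j") auto
  have "limitin T (\<lambda>t. if b = q then y * t\<^sup>2 * adj_mat A $$ (q, p) else 0)
      (if b = q then y * 0\<^sup>2 * adj_mat A $$ (q, p) else 0) (atin_within T 0 S)"
    using lim_mult[OF lim_mult[OF lim_const sq] lim_const] by (cases "b = q") auto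
  then have r: "limitin T ?r (?r 0) (atin_within T 0 S)"
    by (intro lim_diff lim_mult lim_const)
  have lim: "limitin T (\<lambda>t. (if a = b then 1 else 0) + ?m t * ?m' t * ?r t)
      ((if a = b then 1 else 0) + ?m 0 * ?m' 0 * ?r 0) (atin_within T 0 S)"
    by (intro lim_add lim_mult m m' r lim_const)
  \<comment> \<open>At zero the row factor vanishes unless \<open>a = i\<close> and the column
    factor unless \<open>b = j\<close>, so only the entry \<open>(i, j)\<close> differs from the
    identity.\<close>
  have val: "(if a = b then 1 else 0) + ?m 0 * ?m' 0 * ?r 0 =
      addrow_mat n (y * (A $$ (i, p) * adj_mat A $$ (q, j) - (if i = p \<and> j = q then 1 else 0))) i j $$ (a, b)"
    using ab ij by (auto simp: algebra_simps)
  have "eventually (\<lambda>t. t \<noteq> 0) (atin_within T 0 S)"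
    using openin_topspace[of T] by (auto simp: eventually_atin_within)
  then have "eventually (\<lambda>t. (if a = b then 1 else 0) + ?m t * ?m' t * ?r t =
      squeezed_commutator n p q i j A y t $$ (a, b)) (atin_within T 0 S)"
    by eventually_elim (use squeezed_commutator_index[OF A pq ij ab] in simp)
  from limitin_transform_eventually[OF this lim]
  show "limitin T (\<lambda>t. squeezed_commutator n p q i j A y t $$ (a, b))
    (addrow_mat n (y * (A $$ (i, p) * adj_mat A $$ (q, j) - (if i = p \<and> j = q then 1 else 0))) i j $$ (a, b))
    (atin_within T 0 S)"
    unfolding val .
qed

end

text \<open>The closure properties shared by normal subgroups of \<open>SL n S\<close> and by the
  limit kernel. Members may have entries outside \<open>S\<close>, whereas conjugation is only by
  matrices over \<open>S\<close>.\<close>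

definition SL_invariant :: "nat \<Rightarrow> 'a::field set \<Rightarrow> 'a mat set \<Rightarrow> bool" where
  "SL_invariant n S N \<longleftrightarrow> (\<forall>A\<in>N. A \<in> carrier_mat n n \<and> det A = 1 \<and> adj_mat A \<in> N) \<and>
    (\<forall>A\<in>N. \<forall>B\<in>N. A * B \<in> N) \<and> (\<forall>g\<in>carrier (SL n S). \<forall>A\<in>N. g * A * adj_mat g \<in> N)"

text \<open>Bracketed suitably, the commutator is \<open>A\<close> times a conjugate of its inverse
  by an elementary matrix over \<open>F\<close>; the torus matrix, also over \<open>F\<close>,
  conjugates once more.\<close>

lemma (in subfield_set) squeezed_commutator_mem:
  assumes N: "SL_invariant n F N" and A: "A \<in> N" and y: "y \<in> F" and t: "t \<in> F" "t \<noteq> 0"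
    and pq: "p < n" "q < n" "p \<noteq> q" and ij: "i < n" "j < n" "i \<noteq> j"
  shows "squeezed_commutator n p q i j A y t \<in> N"
proof -
  let ?u = "addrow_mat n (y * t\<^sup>2) p q"
  have u: "?u \<in> carrier (SL n F)" using y t pq by (intro addrow_mat_carrier_SL mult_in power_in)
  have tor: "torus_mat n i j t \<in> carrier (SL n F)"
    using t ij by (auto simp: carrier_SL det_torus_mat) (auto simp: torus_mat_def inverse_in)
  have Ac: "A \<in> carrier_mat n n" "adj_mat A \<in> carrier_mat n n" "adj_mat A \<in> N"
    using N A unfolding SL_invariant_def by blast+
  have uc: "?u \<in> carrier_mat n n" "adj_mat ?u \<in> carrier_mat n n" by (simp_all add: adj_mat)
  have "?u * adj_mat A * adj_mat ?u \<in> N"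
    using N Ac(3) u unfolding SL_invariant_def by blast
  then have "?u * (adj_mat A * adj_mat ?u) \<in> N"
    by (simp add: assoc_mult_mat[OF uc(1) Ac(2) uc(2)])
  then have "A * (?u * (adj_mat A * adj_mat ?u)) \<in> N"
    using N A unfolding SL_invariant_def by blast
  then show ?thesis using N tor unfolding SL_invariant_def squeezed_commutator_def by blast
qed

section \<open>Coarser group topologies\<close>

lemma (in top_field) lim_addrow_mat:
  assumes "limitin T f c F"
  shows "limitin (mat_topology n T) (\<lambda>x. addrow_mat n (f x) i j) (addrow_mat n c i j) F"
  using assms lim_add[OF assms lim_const] by (auto simp: limitin_mat_topology)

lemma (in top_field) limitin_matI:
  assumes "eventually (\<lambda>x. g x \<in> carrier_mat n n) F"
    and "\<And>i j. i < n \<Longrightarrow> j < n \<Longrightarrow> limitin T (\<lambda>x. g x $$ (i, j)) (f i j) F"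
  shows "limitin (mat_topology n T) g (mat n n (\<lambda>(i, j). f i j)) F"
  using assms by (auto simp: limitin_mat_topology)

text \<open>Dividing by a dominant entry makes all entries converge, and the entry 1 at
  \<open>(r, s)\<close> keeps the limit nonzero. If the dominant entry itself converges, multiplying
  back shows that \<open>X\<close> does too.\<close>

lemma (in local_top_field) ultrafilter_normalized_limit:
  assumes U: "ultrafilter \<U>" and n: "0 < n"
    and X: "eventually (\<lambda>x. X x \<in> carrier_mat n n \<and> det (X x) = 1) \<U>"
  obtains A r s where "r < n" "s < n" "A $$ (r, s) = 1"
    "limitin (mat_topology n T) (\<lambda>x. inverse (X x $$ (r, s)) \<cdot>\<^sub>m X x) A \<U>"
    "(\<exists>A'. limitin (mat_topology n T) X A' \<U>) \<or> limitin T (\<lambda>x. inverse (X x $$ (r, s))) 0 \<U>"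
proof -
  let ?I = "{..<n} \<times> {..<n}"
  define f where "f ij x = X x $$ ij" for ij x
  have X': "eventually (\<lambda>x. X x \<in> carrier_mat n n) \<U>" using X by eventually_elim simp
  \<comment> \<open>If all entries were eventually zero, the corner entry of \<open>X x\<close>
    times its inverse would be 0 instead of 1.\<close>
  have "\<exists>ij\<in>?I. eventually (\<lambda>x. f ij x \<noteq> 0) \<U>"
  proof (rule ccontr)
    assume "\<not> ?thesis"
    then have "eventually (\<lambda>x. \<forall>ij\<in>?I. f ij x = 0) \<U>"
      using ultrafilter_not_eventually[OF U] by (intro eventually_ball_finite) fastforce+
    with X have "eventually (\<lambda>x. False) \<U>"
    proof eventually_elim
      case (elim x)
      have "(X x * adj_mat (X x)) $$ (0, 0) = (\<Sum>l<n. X x $$ (0, l) * adj_mat (X x) $$ (l, 0))"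
        using elim n adj_mat(1) by (intro index_mult_mat_sum) auto
      also have "\<dots> = 0" using elim n by (intro sum.neutral) (auto simp: f_def)
      finally show ?case using elim n adj_mat_SL(2)[of "X x" n] by simp
    qed
    then show False using ultrafilter_neq_bot[OF U] by simp
  qed
  then obtain r where r: "r \<in> ?I" "eventually (\<lambda>x. f r x \<noteq> 0) \<U>"
    "\<forall>i\<in>?I. \<exists>l. limitin T (\<lambda>x. inverse (f r x) * f i x) l \<U>"
    using ultrafilter_dominant[OF U, of ?I f] by auto
  then obtain l where l: "\<And>i. i \<in> ?I \<Longrightarrow> limitin T (\<lambda>x. inverse (f r x) * f i x) (l i) \<U>"
    by metis
  have "eventually (\<lambda>x. inverse (f r x) * f r x = 1) \<U>" using r(2) by eventually_elim simp
  then have lr: "l r = 1" using lim_eq_const[OF l[OF r(1)]] ultrafilter_neq_bot[OF U] by blast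
  have lim: "limitin (mat_topology n T) (\<lambda>x. inverse (X x $$ r) \<cdot>\<^sub>m X x) (mat n n (\<lambda>(i, j). l (i, j))) \<U>"
  proof (rule limitin_matI)
    show "eventually (\<lambda>x. inverse (X x $$ r) \<cdot>\<^sub>m X x \<in> carrier_mat n n) \<U>"
      using X' by eventually_elim simp
    fix i j assume ij: "i < n" "j < n"
    have "eventually (\<lambda>x. inverse (f r x) * f (i, j) x = (inverse (X x $$ r) \<cdot>\<^sub>m X x) $$ (i, j)) \<U>"
      using X' by eventually_elim (use ij in \<open>auto simp: f_def\<close>)
    moreover have "limitin T (\<lambda>x. inverse (f r x) * f (i, j) x) (l (i, j)) \<U>" using l ij by simp
    ultimately show "limitin T (\<lambda>x. (inverse (X x $$ r) \<cdot>\<^sub>m X x) $$ (i, j)) (l (i, j)) \<U>"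
      by (rule limitin_transform_eventually)
  qed
  have "(\<exists>A'. limitin (mat_topology n T) X A' \<U>) \<or> limitin T (\<lambda>x. inverse (X x $$ r)) 0 \<U>"
    using ultrafilter_limit_or_inverse_null[OF U, of "f r"]
  proof
    assume "\<exists>m. limitin T (f r) m \<U>"
    then obtain m where m: "limitin T (f r) m \<U>" by blast
    have "limitin (mat_topology n T) X (mat n n (\<lambda>(i, j). m * l (i, j))) \<U>"
    proof (rule limitin_matI[OF X'])
      fix i j assume "i < n" "j < n"
      then have "limitin T (\<lambda>x. f r x * (inverse (f r x) * f (i, j) x)) (m * l (i, j)) \<U>"
        by (intro lim_mult m l) simp
      moreover have "eventually (\<lambda>x. f r x * (inverse (f r x) * f (i, j) x) = X x $$ (i, j)) \<U>"
        using r(2) by eventually_elim (simp add: f_def)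
      ultimately show "limitin T (\<lambda>x. X x $$ (i, j)) (m * l (i, j)) \<U>"
        by (auto intro: limitin_transform_eventually)
    qed
    then show ?thesis by blast
  qed (simp add: f_def)
  with lim lr r(1) show ?thesis
    by (intro that[of "fst r" "snd r" "mat n n (\<lambda>(i, j). l (i, j))"]) auto
qed

section \<open>A coarser Hausdorff group topology and its limit kernel\<close>

locale coarser_SL_topology = local_top_field T + subfield_set F
  for T :: "'a::field topology" and F :: "'a set" +
  fixes n k :: nat and S :: "'a mat topology"
  assumes n_eq: "n = 2 ^ k" and k_pos: "1 \<le> k" and infinite_F: "infinite F"
    and top_group: "topological_group (SL n F) S"
    and coarser: "openin S U \<Longrightarrow> openin (SL_topology n F T) U"
begin

abbreviation "M \<equiv> mat_topology n T"

lemma n_ge_2: "2 \<le> n"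
  unfolding n_eq using power_increasing[OF k_pos, of "2::nat"] by simp

lemma topspace_S: "topspace S = carrier (SL n F)"
  using top_group by (simp add: topological_group_def)

lemma Hausdorff_S: "Hausdorff_space S"
  using top_group by (simp add: topological_group_def)

lemma one_SL [simp]: "1\<^sub>m n \<in> carrier (SL n F)"
  by (auto simp: carrier_SL)

lemma limitin_S_eventually: "limitin S g A G \<Longrightarrow> eventually (\<lambda>x. g x \<in> carrier (SL n F)) G"
  using topspace_S by (metis limitin_def openin_topspace)

lemma limitin_S_carrier: "limitin S g A G \<Longrightarrow> A \<in> carrier (SL n F)"
  using topspace_S limitin_topspace by metis

lemma lim_S_const: "A \<in> carrier (SL n F) \<Longrightarrow> limitin S (\<lambda>_. A) A G"
  by (simp add: topspace_S)

lemma lim_S_mult: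
  assumes "limitin S g A G" "limitin S h B G"
  shows "limitin S (\<lambda>x. g x * h x) (A * B) G"
  using top_group continuous_map_limit[of "prod_topology S S" S "\<lambda>(x, y). x * y" "\<lambda>x. (g x, h x)" "(A, B)" G] assms
  by (auto simp: topological_group_def limitin_pairwise o_def)

lemma lim_S_adj_mat:
  assumes "limitin S g A G"
  shows "limitin S (\<lambda>x. adj_mat (g x)) (adj_mat A) G"
proof -
  have "limitin S (\<lambda>x. inv\<^bsub>SL n F\<^esub> (g x)) (adj_mat A) G"
    using top_group continuous_map_limit[of S S "\<lambda>x. inv\<^bsub>SL n F\<^esub> x" g A G] assms limitin_S_carrier[OF assms]
    by (auto simp: topological_group_def o_def inv_SL)
  moreover have "eventually (\<lambda>x. inv\<^bsub>SL n F\<^esub> (g x) = adj_mat (g x)) G"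
    using limitin_S_eventually[OF assms] by eventually_elim (simp add: inv_SL)
  ultimately show ?thesis by (auto intro: limitin_transform_eventually)
qed

lemma lim_S_coarser:
  assumes "limitin (SL_topology n F T) g A G" shows "limitin S g A G"
proof -
  have "A \<in> topspace S" using assms by (simp add: topspace_S limitin_SL_topology)
  then show ?thesis using assms coarser by (auto simp: limitin_def)
qed

text \<open>Equivalently, the intersection of the closures, in the ambient matrix space, of all
  \<open>S\<close>-neighbourhoods of the identity.\<close>

definition limit_kernel :: "'a mat set" where
  "limit_kernel = {A. \<exists>G. G \<noteq> bot \<and> limitin M (\<lambda>x. x) A G \<and> limitin S (\<lambda>x. x) (1\<^sub>m n) G}"

lemma limit_kernelI:
  assumes "limitin M g A G" "limitin S g (1\<^sub>m n) G" "G \<noteq> bot"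
  shows "A \<in> limit_kernel"
  unfolding limit_kernel_def
  using assms by (auto intro!: exI[of _ "filtermap g G"] simp: limitin_filtermap filtermap_bot_iff)

text \<open>Each operation is continuous both entrywise and in \<open>S\<close>, so it can be
  applied along the filter that witnesses membership. For products the two witnesses are run
  independently on the product filter.\<close>

lemma limit_kernel_invariant: "SL_invariant n F limit_kernel"
  unfolding SL_invariant_def
proof (intro conjI ballI)
  fix A assume "A \<in> limit_kernel"
  then obtain G where G: "G \<noteq> bot" "limitin M (\<lambda>x. x) A G" "limitin S (\<lambda>x. x) (1\<^sub>m n) G"
    by (auto simp: limit_kernel_def)
  show A: "A \<in> carrier_mat n n" using G(2) by (simp add: limitin_mat_topology)
  have "eventually (\<lambda>x. det x = 1) G"
    using limitin_S_eventually[OF G(3)] by eventually_elim (simp add: carrier_SL)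
  then show "det A = 1" using lim_eq_const[OF lim_det[OF G(2)]] G(1) by blast
  have adj1: "adj_mat (1\<^sub>m n :: 'a mat) = 1\<^sub>m n" by (rule adj_mat_unique) auto
  show "adj_mat A \<in> limit_kernel"
    using limit_kernelI[OF lim_adj_mat[OF G(2)] _ G(1)] lim_S_adj_mat[OF G(3)] by (simp add: adj1)
  fix g assume g: "g \<in> carrier (SL n F)"
  then have gc: "g \<in> carrier_mat n n" "det g = 1" by (auto simp: carrier_SL)
  have "limitin S (\<lambda>x. g * x * adj_mat g) (g * 1\<^sub>m n * adj_mat g) G"
    by (intro lim_S_mult lim_S_const G g adj_mat_carrier_SL)
  moreover have "g * 1\<^sub>m n * adj_mat g = 1\<^sub>m n" using gc adj_mat_SL[OF gc] by simp
  moreover have "limitin M (\<lambda>x. g * x * adj_mat g) (g * A * adj_mat g) G"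
    using gc adj_mat_SL[OF gc]
    by (intro lim_mat_mult G) (auto simp: topspace_mat_topology)
  ultimately show "g * A * adj_mat g \<in> limit_kernel"
    using G(1) by (intro limit_kernelI) auto
next
  fix A B assume "A \<in> limit_kernel" "B \<in> limit_kernel"
  then obtain G H where G: "G \<noteq> bot" "limitin M (\<lambda>x. x) A G" "limitin S (\<lambda>x. x) (1\<^sub>m n) G"
    and H: "H \<noteq> bot" "limitin M (\<lambda>x. x) B H" "limitin S (\<lambda>x. x) (1\<^sub>m n) H"
    by (auto simp: limit_kernel_def)
  have "limitin M (\<lambda>x. fst x * snd x) (A * B) (G \<times>\<^sub>F H)"
    by (intro lim_mat_mult limitin_fst limitin_snd G H)
  moreover have "limitin S (\<lambda>x. fst x * snd x) (1\<^sub>m n * 1\<^sub>m n) (G \<times>\<^sub>F H)"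
    by (intro lim_S_mult limitin_fst limitin_snd G H)
  ultimately show "A * B \<in> limit_kernel"
    using G(1) H(1)
    by (intro limit_kernelI[where G = "G \<times>\<^sub>F H"]) (auto simp: prod_filter_eq_bot)
qed

text \<open>The witness is the common refinement of the neighbourhood filters of \<open>A\<close> in
  \<open>M\<close> and of the identity in \<open>S\<close>. It is proper because every neighbourhood
  of \<open>A\<close> contains some kernel element \<open>f x\<close>, whose own witness meets both
  neighbourhoods.\<close>

lemma limit_kernel_closed:
  assumes f: "limitin M f A H" "H \<noteq> bot" "eventually (\<lambda>x. f x \<in> limit_kernel) H"
  shows "A \<in> limit_kernel"
proof -
  have A: "A \<in> topspace M" using f(1) limitin_topspace by metis
  have one: "1\<^sub>m n \<in> topspace S" by (simp add: topspace_S)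
  let ?G = "inf (nhdsin M A) (nhdsin S (1\<^sub>m n))"
  have "?G \<noteq> bot"
  proof
    assume "?G = bot"
    then have "eventually (\<lambda>_. False) ?G" by simp
    then obtain P Q where PQ: "eventually P (nhdsin M A)" "eventually Q (nhdsin S (1\<^sub>m n))"
      "\<And>x. \<not> (P x \<and> Q x)"
      unfolding eventually_inf by blast
    obtain U where U: "openin M U" "A \<in> U" "\<forall>x\<in>U. P x"
      using PQ(1) A unfolding eventually_nhdsin by blast
    obtain V where V: "openin S V" "1\<^sub>m n \<in> V" "\<forall>x\<in>V. Q x"
      using PQ(2) one unfolding eventually_nhdsin by blast
    have UV: "U \<inter> V = {}" using PQ(3) U(3) V(3) by blast
    have "eventually (\<lambda>x. f x \<in> U \<and> f x \<in> limit_kernel) H"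
      using limitinD[OF f(1) U(1,2)] f(3) by eventually_elim simp
    then obtain x where "f x \<in> U" "f x \<in> limit_kernel"
      using f(2) by (auto dest: eventually_happens)
    then obtain G where G: "G \<noteq> bot" "limitin M (\<lambda>x. x) (f x) G" "limitin S (\<lambda>x. x) (1\<^sub>m n) G"
      by (auto simp: limit_kernel_def)
    have "eventually (\<lambda>_. False) G"
      using limitinD[OF G(2) U(1) \<open>f x \<in> U\<close>] limitinD[OF G(3) V(1,2)] by eventually_elim (use UV in auto)
    then show False using G(1) by simp
  qed
  moreover have "limitin M (\<lambda>x. x) A ?G" "limitin S (\<lambda>x. x) (1\<^sub>m n) ?G"
    using A one by (simp_all add: limitin_nhdsin)
  ultimately show ?thesis by (auto simp: limit_kernel_def)
qed

text \<open>If \<open>A\<close> lies over \<open>F\<close>, entrywise convergence to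
  \<open>A\<close> is convergence in the given topology, hence in \<open>S\<close>; the Hausdorff
  property of \<open>S\<close> identifies the two limits.\<close>

lemma limit_kernel_Int:
  assumes "A \<in> limit_kernel" "A \<in> carrier (SL n F)" shows "A = 1\<^sub>m n"
proof -
  obtain G where G: "G \<noteq> bot" "limitin M (\<lambda>x. x) A G" "limitin S (\<lambda>x. x) (1\<^sub>m n) G"
    using assms by (auto simp: limit_kernel_def)
  have "limitin S (\<lambda>x. x) A G"
    using assms(2) G limitin_S_eventually[OF G(3)] by (intro lim_S_coarser) (simp add: limitin_SL_topology)
  then show ?thesis using limitin_Hausdorff_unique[OF _ G(3) G(1) Hausdorff_S] by blast
qed

text \<open>Squeezing a nonscalar \<open>A\<close> gives elementary matrices with entry
  \<open>y * \<gamma> A\<close>, where \<open>\<gamma> A\<close> may lie outside \<open>F\<close>.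
  Letting \<open>y\<close> run through \<open>inverse (\<gamma> x)\<close>, for matrices
  \<open>x\<close> over \<open>F\<close> tending to \<open>A\<close>, makes the entry tend to 1, and
  the limit is over \<open>F\<close>.\<close>

lemma limit_kernel_scalar:
  assumes A: "A \<in> limit_kernel" shows "\<exists>c. A = c \<cdot>\<^sub>m 1\<^sub>m n"
proof (rule ccontr)
  assume no: "\<not> ?thesis"
  have Ac: "A \<in> carrier_mat n n" "det A = 1"
    using limit_kernel_invariant A by (auto simp: SL_invariant_def)
  note adj = adj_mat_SL[OF Ac]
  obtain p q i j where pq: "p < n" "q < n" "p \<noteq> q" and ij: "i < n" "j < n" "i \<noteq> j"
    and neq: "A $$ (i, p) * adj_mat A $$ (q, j) \<noteq> (if i = p \<and> j = q then 1 else 0)"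
    using nonscalar_witness[OF n_ge_2 Ac(1) adj(1,2)] no by metis
  define \<gamma> where "\<gamma> X = X $$ (i, p) * adj_mat X $$ (q, j) - (if i = p \<and> j = q then 1 else 0)" for X :: "'a mat"
  have nz: "\<gamma> A \<noteq> 0" using neq by (simp add: \<gamma>_def)
  have mem: "addrow_mat n (y * \<gamma> A) i j \<in> limit_kernel" if y: "y \<in> F" for y
  proof (rule limit_kernel_closed)
    show "limitin M (squeezed_commutator n p q i j A y) (addrow_mat n (y * \<gamma> A) i j) (atin_within T 0 F)"
      unfolding \<gamma>_def by (rule lim_squeezed_commutator[OF Ac pq ij])
    show "atin_within T 0 F \<noteq> bot"
      using infinite_subfield_zero_limit_point diff_in inverse_in infinite_F by blast
    have "eventually (\<lambda>t. t \<in> F \<and> t \<noteq> 0) (atin_within T 0 F)"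
      using openin_topspace[of T] by (auto simp: eventually_atin_within)
    then show "eventually (\<lambda>t. squeezed_commutator n p q i j A y t \<in> limit_kernel) (atin_within T 0 F)"
      by eventually_elim (use squeezed_commutator_mem[OF limit_kernel_invariant A y _ _ pq ij] in blast)
  qed
  obtain G where G: "G \<noteq> bot" "limitin M (\<lambda>x. x) A G" "limitin S (\<lambda>x. x) (1\<^sub>m n) G"
    using A by (auto simp: limit_kernel_def)
  have "limitin T \<gamma> (\<gamma> A) G"
    unfolding \<gamma>_def using G(2) lim_adj_mat[OF G(2)] pq ij
    by (intro lim_diff lim_mult lim_const) (auto simp: limitin_mat_topology)
  then have "limitin T (\<lambda>x. inverse (\<gamma> x) * \<gamma> A) (inverse (\<gamma> A) * \<gamma> A) G"
    using nz by (intro lim_mult lim_inverse lim_const)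
  then have lim: "limitin M (\<lambda>x. addrow_mat n (inverse (\<gamma> x) * \<gamma> A) i j) (addrow_mat n 1 i j) G"
    using nz lim_addrow_mat by fastforce
  have "eventually (\<lambda>x. addrow_mat n (inverse (\<gamma> x) * \<gamma> A) i j \<in> limit_kernel) G"
    using limitin_S_eventually[OF G(3)]
  proof eventually_elim
    case (elim x)
    then have "\<gamma> x \<in> F"
      unfolding \<gamma>_def using pq ij adj_mat_in[of x n q j] by (auto simp: carrier_SL intro!: diff_in mult_in)
    then show ?case by (intro mem inverse_in)
  qed
  from limit_kernel_closed[OF lim G(1) this] have "addrow_mat n 1 i j = (1\<^sub>m n :: 'a mat)"
    using ij by (intro limit_kernel_Int addrow_mat_carrier_SL) auto
  then have "addrow_mat n 1 i j $$ (i, j) = (1\<^sub>m n :: 'a mat) $$ (i, j)" by simp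
  then show False using ij by simp
qed

lemma limit_kernel_trivial:
  assumes A: "A \<in> limit_kernel" shows "A = 1\<^sub>m n"
proof -
  obtain c where c: "A = c \<cdot>\<^sub>m 1\<^sub>m n" using limit_kernel_scalar[OF A] by blast
  have pow: "c ^ (2 ^ m) \<cdot>\<^sub>m 1\<^sub>m n \<in> limit_kernel" for m
  proof (induction m)
    case (Suc m)
    then have "(c ^ (2 ^ m) \<cdot>\<^sub>m 1\<^sub>m n) * (c ^ (2 ^ m) \<cdot>\<^sub>m 1\<^sub>m n) \<in> limit_kernel"
      using limit_kernel_invariant by (auto simp: SL_invariant_def)
    moreover have "(c ^ (2 ^ m) \<cdot>\<^sub>m 1\<^sub>m n) * (c ^ (2 ^ m) \<cdot>\<^sub>m 1\<^sub>m n) = c ^ (2 ^ Suc m) \<cdot>\<^sub>m 1\<^sub>m n"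
      by (intro eq_matI) (auto simp: mult_2 power_add)
    ultimately show ?case by simp
  qed (use A c in simp)
  have "det A = 1" using limit_kernel_invariant A by (auto simp: SL_invariant_def)
  then have ck: "c ^ (2 ^ k) = 1" using c by (simp add: n_eq)
  have "c = 1"
  proof (rule ccontr)
    assume c1: "c \<noteq> 1"
    \<comment> \<open>By minimality the power one step before the first 1 is a square root of 1
      other than 1, hence -1. As \<open>n\<close> is even, the scalar matrix -1 has determinant 1
      and lies in \<open>SL n F\<close>, where the kernel holds only the identity.\<close>
    define m where "m = (LEAST m. c ^ (2 ^ m) = 1)"
    have m: "c ^ (2 ^ m) = 1" unfolding m_def using ck by (rule LeastI)
    have "m \<noteq> 0" using m c1 by (cases m) auto
    then obtain l where l: "m = Suc l" by (cases m) auto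
    have ne: "c ^ (2 ^ l) \<noteq> 1" using not_less_Least[of l "\<lambda>m. c ^ (2 ^ m) = 1"] l by (simp add: m_def)
    have "(c ^ (2 ^ l))\<^sup>2 = 1" using m l by (simp add: power_mult[symmetric] mult.commute)
    then have mu: "c ^ (2 ^ l) = - 1" using ne power2_eq_1_iff by blast
    have "even n" using k_pos by (simp add: n_eq)
    then have "(- 1) \<cdot>\<^sub>m 1\<^sub>m n \<in> carrier (SL n F)"
      using minus_in[OF one_in] by (auto simp: carrier_SL)
    then have "(- 1) \<cdot>\<^sub>m 1\<^sub>m n = (1\<^sub>m n :: 'a mat)"
      using limit_kernel_Int[OF pow[of l]] unfolding mu by blast
    then have "((- 1) \<cdot>\<^sub>m 1\<^sub>m n) $$ (0, 0) = (1\<^sub>m n :: 'a mat) $$ (0, 0)" by simp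
    then show False using ne mu n_ge_2 by simp
  qed
  then show ?thesis using c by auto
qed

lemma ultrafilter_limit:
  assumes U: "ultrafilter \<U>" and g: "limitin S g (1\<^sub>m n) \<U>"
  shows "limitin M g (1\<^sub>m n) \<U>"
proof -
  \<comment> \<open>Any entrywise limit of \<open>g\<close> belongs to the limit kernel, so it is
    the identity.\<close>
  have bounded: ?thesis if "limitin M g A \<U>" for A
    using limit_kernel_trivial[OF limit_kernelI[OF that g ultrafilter_neq_bot[OF U]]] that by simp
  let ?h = "\<lambda>x. adj_mat (g x)"
  have h: "limitin S ?h (adj_mat (1\<^sub>m n)) \<U>" by (rule lim_S_adj_mat[OF g])
  have gS: "eventually (\<lambda>x. g x \<in> carrier (SL n F)) \<U>" by (rule limitin_S_eventually[OF g])
  have hS: "eventually (\<lambda>x. ?h x \<in> carrier (SL n F)) \<U>" by (rule limitin_S_eventually[OF h])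
  have n: "0 < n" using n_ge_2 by simp
  have g1: "eventually (\<lambda>x. g x \<in> carrier_mat n n \<and> det (g x) = 1) \<U>"
    using gS by eventually_elim (simp add: carrier_SL)
  obtain A r s where A: "r < n" "s < n" "A $$ (r, s) = 1"
    "limitin M (\<lambda>x. inverse (g x $$ (r, s)) \<cdot>\<^sub>m g x) A \<U>"
    "(\<exists>A'. limitin M g A' \<U>) \<or> limitin T (\<lambda>x. inverse (g x $$ (r, s))) 0 \<U>"
    by (rule ultrafilter_normalized_limit[OF U n g1]) (rule that; assumption)
  have h1: "eventually (\<lambda>x. ?h x \<in> carrier_mat n n \<and> det (?h x) = 1) \<U>"
    using hS by eventually_elim (simp add: carrier_SL)
  obtain B r' s' where B: "r' < n" "s' < n" "B $$ (r', s') = 1"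
    "limitin M (\<lambda>x. inverse (?h x $$ (r', s')) \<cdot>\<^sub>m ?h x) B \<U>"
    "(\<exists>B'. limitin M ?h B' \<U>) \<or> limitin T (\<lambda>x. inverse (?h x $$ (r', s'))) 0 \<U>"
    by (rule ultrafilter_normalized_limit[OF U n h1]) (rule that; assumption)
  define c where "c x = inverse (g x $$ (r, s))" for x
  define d where "d x = inverse (?h x $$ (r', s'))" for x
  show ?thesis
  \<comment> \<open>If one of the two does not tend to zero, then \<open>g\<close> or its inverse
    converges entrywise, and in the latter case \<open>g\<close> converges as the adjugate of its
    inverse.\<close>
  proof (cases "limitin T c 0 \<U> \<and> limitin T d 0 \<U>")
    case False
    show ?thesis
    proof (cases "\<exists>A'. limitin M g A' \<U>")
      case True
      then show ?thesis using bounded by blast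
    next
      case no: False
      then obtain H where "limitin M ?h H \<U>" using False A(5) B(5) by (auto simp: c_def[abs_def] d_def[abs_def])
      from lim_adj_mat[OF this] have "limitin M (\<lambda>x. adj_mat (?h x)) (adj_mat H) \<U>" .
      moreover have "eventually (\<lambda>x. adj_mat (?h x) = g x) \<U>"
        using gS by eventually_elim (use adj_mat_SL in \<open>auto simp: carrier_SL intro!: adj_mat_unique[of _ n]\<close>)
      ultimately show ?thesis using no by (auto intro: limitin_transform_eventually)
    qed
  next
    case True
    then have cd: "limitin T (\<lambda>x. c x * d x) 0 \<U>" using lim_mult[of c 0 \<U> d 0] by simp
    have Ac: "A \<in> carrier_mat n n" and Bc: "B \<in> carrier_mat n n"
      using A(4) B(4) by (auto simp: limitin_mat_topology)
    have gm: "limitin T (\<lambda>x. c x * g x $$ (a, b)) (A $$ (a, b)) \<U>" if "a < n" "b < n" for a b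
    proof (rule limitin_transform_eventually)
      show "limitin T (\<lambda>x. (inverse (g x $$ (r, s)) \<cdot>\<^sub>m g x) $$ (a, b)) (A $$ (a, b)) \<U>"
        using A(4) that by (simp add: limitin_mat_topology)
      show "eventually (\<lambda>x. (inverse (g x $$ (r, s)) \<cdot>\<^sub>m g x) $$ (a, b) = c x * g x $$ (a, b)) \<U>"
        using gS by eventually_elim (use that in \<open>auto simp: carrier_SL c_def\<close>)
    qed
    have hm: "limitin T (\<lambda>x. d x * ?h x $$ (a, b)) (B $$ (a, b)) \<U>" if "a < n" "b < n" for a b
    proof (rule limitin_transform_eventually)
      show "limitin T (\<lambda>x. (inverse (?h x $$ (r', s')) \<cdot>\<^sub>m ?h x) $$ (a, b)) (B $$ (a, b)) \<U>"
        using B(4) that by (simp add: limitin_mat_topology)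
      show "eventually (\<lambda>x. (inverse (?h x $$ (r', s')) \<cdot>\<^sub>m ?h x) $$ (a, b) = d x * ?h x $$ (a, b)) \<U>"
        using hS by eventually_elim (use that in \<open>auto simp: carrier_SL d_def\<close>)
    qed
    \<comment> \<open>The product of the normalized matrices is \<open>c x * d x\<close> times the
      identity, which tends to zero.\<close>
    have AB: "(\<Sum>l<n. A $$ (a, l) * B $$ (l, b)) = 0" if ab: "a < n" "b < n" for a b
    proof -
      have "limitin T (\<lambda>x. \<Sum>l<n. (c x * g x $$ (a, l)) * (d x * ?h x $$ (l, b)))
          (\<Sum>l<n. A $$ (a, l) * B $$ (l, b)) \<U>"
        using ab by (intro lim_sum lim_mult gm hm) auto
      moreover have "eventually (\<lambda>x. (\<Sum>l<n. (c x * g x $$ (a, l)) * (d x * ?h x $$ (l, b))) =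
          c x * d x * 1\<^sub>m n $$ (a, b)) \<U>"
        using gS
      proof eventually_elim
        case (elim x)
        then have gx: "g x \<in> carrier_mat n n" "det (g x) = 1" by (auto simp: carrier_SL)
        have "(\<Sum>l<n. (c x * g x $$ (a, l)) * (d x * ?h x $$ (l, b))) =
            c x * d x * (\<Sum>l<n. g x $$ (a, l) * ?h x $$ (l, b))"
          by (simp add: sum_distrib_left mult_ac)
        also have "(\<Sum>l<n. g x $$ (a, l) * ?h x $$ (l, b)) = (g x * ?h x) $$ (a, b)"
          using gx adj_mat_SL[OF gx] ab by (intro index_mult_mat_sum[symmetric]) auto
        finally show ?case using adj_mat_SL[OF gx] by simp
      qed
      ultimately have "limitin T (\<lambda>x. c x * d x * 1\<^sub>m n $$ (a, b)) (\<Sum>l<n. A $$ (a, l) * B $$ (l, b)) \<U>"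
        by (auto intro: limitin_transform_eventually)
      moreover have "limitin T (\<lambda>x. c x * d x * 1\<^sub>m n $$ (a, b)) (0 * 1\<^sub>m n $$ (a, b)) \<U>"
        by (intro lim_mult cd lim_const)
      ultimately show ?thesis using lim_unique ultrafilter_neq_bot[OF U] by fastforce
    qed
    \<comment> \<open>The normalized entries are 1 at \<open>(r, s)\<close> in \<open>A\<close> and
      at \<open>(r', s')\<close> in \<open>B\<close>. If \<open>s\<close> and \<open>r'\<close>
      differ they serve as \<open>p\<close> and \<open>q\<close>. If they agree, the vanishing entry
      \<open>(r, s')\<close> of \<open>A * B\<close> has the summand 1 at \<open>s\<close>, so
      another summand \<open>l\<close> is nonzero; then \<open>p = l\<close> and
      \<open>q = s\<close>.\<close>
    have "\<exists>p q. p < n \<and> q < n \<and> p \<noteq> q \<and> A $$ (r, p) * B $$ (q, s') \<noteq> 0"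
    proof (cases "s = r'")
      case False
      then show ?thesis using A(2,3) B(1,3) by (intro exI[of _ s] exI[of _ r']) auto
    next
      case True
      have "(\<Sum>l<n. A $$ (r, l) * B $$ (l, s')) = 1 + (\<Sum>l\<in>{..<n} - {s}. A $$ (r, l) * B $$ (l, s'))"
        using A(2,3) B(3) True by (subst sum.remove[of _ s]) auto
      then have "(\<Sum>l\<in>{..<n} - {s}. A $$ (r, l) * B $$ (l, s')) \<noteq> 0"
        using AB[OF A(1) B(2)] by auto
      then obtain l where "l \<in> {..<n} - {s}" "A $$ (r, l) * B $$ (l, s') \<noteq> 0"
        by (meson sum.neutral)
      then show ?thesis using B(3) True A(2) by (intro exI[of _ l] exI[of _ s]) auto
    qed
    then obtain p q where pq: "p < n" "q < n" "p \<noteq> q" "A $$ (r, p) * B $$ (q, s') \<noteq> 0" by blast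
    let ?u = "\<lambda>x. addrow_mat n (c x * d x) p q"
    have "eventually (\<lambda>x. ?u x \<in> carrier (SL n F)) \<U>"
      using gS hS
    proof eventually_elim
      case (elim x)
      then have "c x \<in> F" "d x \<in> F"
        using A(1,2) B(1,2) by (auto simp: c_def d_def carrier_SL intro!: inverse_in)
      then show ?case using pq by (intro addrow_mat_carrier_SL mult_in) auto
    qed
    moreover have "addrow_mat n 0 p q = (1\<^sub>m n :: 'a mat)" by (intro eq_matI) auto
    then have "limitin M ?u (1\<^sub>m n) \<U>" using lim_addrow_mat[OF cd] by metis
    ultimately have u: "limitin S ?u (1\<^sub>m n) \<U>"
      by (intro lim_S_coarser) (simp add: limitin_SL_topology)
    have adj1: "adj_mat (1\<^sub>m n :: 'a mat) = 1\<^sub>m n" by (rule adj_mat_unique) auto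
    have "limitin S (\<lambda>x. g x * (?u x * ?h x)) (1\<^sub>m n * (1\<^sub>m n * adj_mat (1\<^sub>m n))) \<U>"
      by (intro lim_S_mult g u h)
    then have S1: "limitin S (\<lambda>x. g x * (?u x * ?h x)) (1\<^sub>m n) \<U>" by (simp add: adj1)
    have "limitin M (\<lambda>x. g x * (?u x * ?h x))
      (mat n n (\<lambda>(a, b). 1\<^sub>m n $$ (a, b) + A $$ (a, p) * B $$ (q, b))) \<U>"
    proof (rule limitin_matI)
      show "eventually (\<lambda>x. g x * (?u x * ?h x) \<in> carrier_mat n n) \<U>"
        using limitin_S_eventually[OF S1] by eventually_elim (simp add: carrier_SL)
      fix a b assume ab: "a < n" "b < n"
      have "limitin T (\<lambda>x. 1\<^sub>m n $$ (a, b) + (c x * g x $$ (a, p)) * (d x * ?h x $$ (q, b)))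
        (1\<^sub>m n $$ (a, b) + A $$ (a, p) * B $$ (q, b)) \<U>"
        using ab pq by (intro lim_add lim_mult gm hm lim_const)
      moreover have "eventually (\<lambda>x. 1\<^sub>m n $$ (a, b) + (c x * g x $$ (a, p)) * (d x * ?h x $$ (q, b)) =
          (g x * (?u x * ?h x)) $$ (a, b)) \<U>"
        using gS
      proof eventually_elim
        case (elim x)
        then have gx: "g x \<in> carrier_mat n n" "det (g x) = 1" by (auto simp: carrier_SL)
        note adj = adj_mat_SL[OF gx]
        show ?case
          unfolding mult_addrow_mat_mult[OF gx(1) adj(1) pq(1,2) ab] adj(2) by (simp add: mult_ac)
      qed
      ultimately show "limitin T (\<lambda>x. (g x * (?u x * ?h x)) $$ (a, b))
        (1\<^sub>m n $$ (a, b) + A $$ (a, p) * B $$ (q, b)) \<U>"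
        by (auto intro: limitin_transform_eventually)
    qed
    from limit_kernel_trivial[OF limit_kernelI[OF this S1 ultrafilter_neq_bot[OF U]]]
    have "mat n n (\<lambda>(a, b). 1\<^sub>m n $$ (a, b) + A $$ (a, p) * B $$ (q, b)) $$ (r, s') = 1\<^sub>m n $$ (r, s')"
      by simp
    then show ?thesis using pq A(1) B(2) by simp
  qed
qed

text \<open>Continuity of the identity map from \<open>S\<close> is tested along ultrafilters. Left
  translation by the inverse of \<open>A\<close> reduces it to convergence to the identity
  matrix.\<close>

lemma coarser_eq: "S = SL_topology n F T"
proof -
  let ?\<tau> = "SL_topology n F T"
  have "continuous_map S ?\<tau> (\<lambda>x. x)"
    unfolding continuous_map_atin
  proof
    fix A assume A: "A \<in> topspace S"
    then have AS: "A \<in> carrier (SL n F)" by (simp add: topspace_S)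
    then have Ac: "A \<in> carrier_mat n n" "det A = 1" by (auto simp: carrier_SL)
    note adj = adj_mat_SL[OF Ac]
    show "limitin ?\<tau> (\<lambda>x. x) A (atin S A)"
    proof (rule limitin_ultrafilterI)
      show "A \<in> topspace ?\<tau>" using AS by (simp add: topspace_SL_topology)
      fix \<U> assume U: "ultrafilter \<U>" "\<U> \<le> atin S A"
      have id: "limitin S (\<lambda>x. x) A \<U>"
        using A U(2) limitin_continuous_map[of S S "\<lambda>x. x" A A] by (auto intro: limitin_mono)
      have "limitin S (\<lambda>x. adj_mat A * x) (adj_mat A * A) \<U>"
        by (intro lim_S_mult id lim_S_const adj_mat_carrier_SL AS)
      then have "limitin M (\<lambda>x. adj_mat A * x) (1\<^sub>m n) \<U>"
        using ultrafilter_limit[OF U(1)] adj by simp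
      then have "limitin M (\<lambda>x. A * (adj_mat A * x)) (A * 1\<^sub>m n) \<U>"
        using Ac by (intro lim_mat_mult) (auto simp: topspace_mat_topology)
      moreover have "eventually (\<lambda>x. A * (adj_mat A * x) = x) \<U>"
        using limitin_S_eventually[OF id]
      proof eventually_elim
        case (elim x)
        then have x: "x \<in> carrier_mat n n" by (simp add: carrier_SL)
        have "A * (adj_mat A * x) = A * adj_mat A * x"
          by (rule assoc_mult_mat[symmetric, OF Ac(1) adj(1) x])
        then show ?case using adj(2) x by simp
      qed
      ultimately have "limitin M (\<lambda>x. x) A \<U>"
        using Ac by (auto intro: limitin_transform_eventually)
      then show "limitin ?\<tau> (\<lambda>x. x) A \<U>"
        using AS limitin_S_eventually[OF id] by (simp add: limitin_SL_topology)
    qed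
  qed
  then have "openin S U" if "openin ?\<tau> U" for U
    using openin_continuous_map_preimage[of S ?\<tau> "\<lambda>x. x" U] that openin_subset[OF that]
    by (simp add: topspace_S topspace_SL_topology Int_absorb1 Collect_conj_eq)
  then show ?thesis using coarser by (auto simp: topology_eq)
qed

end

section \<open>Quotients and total minimality\<close>

lemma minus_one_CHAR_2:
  assumes "CHAR('a::field) = 2" shows "(- 1 :: 'a) = 1"
proof -
  have "(2 :: 'a) = 0" using of_nat_CHAR[where 'a = 'a] assms by simp
  then show ?thesis by (metis add.right_inverse one_add_one add_left_cancel)
qed

text \<open>A finite Hausdorff space is discrete, so the group carries only one Hausdorff
  topology.\<close>

lemma minimal_group_finite:
  assumes G: "group G" and fin: "finite (carrier G)" and X: "topspace X = carrier G" "Hausdorff_space X"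
  shows "minimal_group G X"
proof -
  interpret group G by fact
  have discrete: "Y = discrete_topology (carrier G)" if "topspace Y = carrier G" "Hausdorff_space Y" for Y
    using finite_topspace_imp_discrete_topology that fin by blast
  have X_eq: "X = discrete_topology (carrier G)" by (rule discrete[OF X])
  have "Hausdorff_space (prod_topology X X)" using X(2) by (simp add: Hausdorff_space_prod_topology)
  then have "prod_topology X X = discrete_topology (carrier G \<times> carrier G)"
    using X(1) fin finite_topspace_imp_discrete_topology[of "prod_topology X X"] by auto
  then have "topological_group G X"
    using X G by (simp add: topological_group_def) (auto simp: X_eq)
  then show ?thesis
    using discrete X_eq by (auto simp: minimal_group_def topological_group_def)
qed

section \<open>Transport along isomorphisms and the simplest quotients\<close>

lemma topological_group_iso:
  assumes G: "topological_group G X" and H: "group H" and iso: "\<phi> \<in> iso G H"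
    and homeo: "homeomorphic_map X Y \<phi>"
  shows "topological_group H Y"
proof -
  interpret G: group G using G by (simp add: topological_group_def)
  interpret H: group H by fact
  have ts: "topspace X = carrier G" and HX: "Hausdorff_space X"
    and cm: "continuous_map (prod_topology X X) X (\<lambda>(x, y). x \<otimes>\<^bsub>G\<^esub> y)"
    and ci: "continuous_map X X (\<lambda>x. inv\<^bsub>G\<^esub> x)"
    using G by (auto simp: topological_group_def)
  have hom: "\<phi> \<in> hom G H" and bij: "bij_betw \<phi> (carrier G) (carrier H)"
    using iso by (auto simp: iso_def)
  obtain \<psi> where maps: "homeomorphic_maps X Y \<phi> \<psi>"
    using homeo homeomorphic_map_maps by blast
  then have c\<phi>: "continuous_map X Y \<phi>" and c\<psi>: "continuous_map Y X \<psi>"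
    and \<phi>\<psi>: "\<And>y. y \<in> topspace Y \<Longrightarrow> \<phi> (\<psi> y) = y"
    by (auto simp: homeomorphic_maps_def)
  have tsY: "topspace Y = carrier H"
    using homeo bij ts by (metis homeomorphic_imp_surjective_map bij_betw_imp_surj_on)
  have \<psi>: "\<psi> y \<in> carrier G" if "y \<in> carrier H" for y
    using c\<psi> that tsY ts by (auto simp: continuous_map_def)
  have "continuous_map (prod_topology Y Y) Y (\<phi> \<circ> (\<lambda>(x, y). x \<otimes>\<^bsub>G\<^esub> y) \<circ> (\<lambda>p. (\<psi> (fst p), \<psi> (snd p))))"
    using c\<psi> continuous_map_compose[OF continuous_map_fst c\<psi>, of Y] continuous_map_compose[OF continuous_map_snd c\<psi>, of Y]
    by (intro continuous_map_compose[OF _ continuous_map_compose[OF cm c\<phi>]])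
      (simp add: continuous_map_pairwise o_def)
  then have m: "continuous_map (prod_topology Y Y) Y (\<lambda>(x, y). x \<otimes>\<^bsub>H\<^esub> y)"
    by (rule continuous_map_eq) (use \<psi> \<phi>\<psi> hom tsY in \<open>auto simp: hom_mult\<close>)
  have "continuous_map Y Y (\<phi> \<circ> (\<lambda>x. inv\<^bsub>G\<^esub> x) \<circ> \<psi>)"
    by (intro continuous_map_compose[OF c\<psi> continuous_map_compose[OF ci c\<phi>]])
  moreover have "\<phi> (inv\<^bsub>G\<^esub> (\<psi> y)) = inv\<^bsub>H\<^esub> y" if "y \<in> carrier H" for y
    using group_hom.hom_inv[of G H \<phi> "\<psi> y"] \<psi>[OF that] \<phi>\<psi> that tsY hom
    by (simp add: group_hom_def group_hom_axioms_def G.is_group H.is_group)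
  ultimately have i: "continuous_map Y Y (\<lambda>y. inv\<^bsub>H\<^esub> y)"
    by (elim continuous_map_eq) (use tsY in auto)
  have "Hausdorff_space Y"
    using HX homeo homeomorphic_Hausdorff_space homeomorphic_space homeomorphic_map_imp_homeomorphic_space by blast
  then show ?thesis using m i tsY H by (simp add: topological_group_def)
qed

text \<open>A topology \<open>S\<close> on \<open>H\<close> coarser than \<open>Y\<close> is pulled
  back along the isomorphism to a group topology coarser than \<open>X\<close>. Minimality makes the
  pullback equal to \<open>X\<close>, and bijectivity carries this back to
  \<open>S = Y\<close>.\<close>

lemma minimal_group_iso:
  assumes min: "minimal_group G X" and H: "group H" and iso: "\<phi> \<in> iso G H"
    and homeo: "homeomorphic_map X Y \<phi>"
  shows "minimal_group H Y"
  unfolding minimal_group_def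
proof (intro conjI allI impI)
  have G: "topological_group G X" using min by (simp add: minimal_group_def)
  then interpret G: group G by (simp add: topological_group_def)
  show Y: "topological_group H Y" by (rule topological_group_iso[OF G H iso homeo])
  fix S assume S: "topological_group H S \<and> (\<forall>U. openin S U \<longrightarrow> openin Y U)"
  have bij: "bij_betw \<phi> (carrier G) (carrier H)" using iso by (auto simp: iso_def)
  have tsX: "topspace X = carrier G" and tsY: "topspace Y = carrier H" and tsS: "topspace S = carrier H"
    using G Y S by (auto simp: topological_group_def)
  define S' where "S' = pullback_topology (carrier G) \<phi> S"
  have tsS': "topspace S' = carrier G"
    using bij by (auto simp: S'_def topspace_pullback_topology tsS bij_betw_def)
  define \<psi> where "\<psi> = inv_into (carrier G) \<phi>"
  have \<psi>iso: "\<psi> \<in> iso H G" unfolding \<psi>_def by (rule G.iso_set_sym[OF iso])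
  have \<psi>: "\<psi> (\<phi> x) = x" if "x \<in> carrier G" for x
    using that bij by (simp add: \<psi>_def bij_betw_def)
  have \<phi>: "\<phi> (\<psi> y) = y" "\<psi> y \<in> carrier G" if "y \<in> carrier H" for y
    using that bij by (auto simp: \<psi>_def bij_betw_def f_inv_into_f inv_into_into)
  have "continuous_map S' S \<phi>"
    using continuous_map_pullback[OF continuous_map_id, of "carrier G" \<phi> S] by (simp add: S'_def o_def)
  moreover have "continuous_map S S (\<phi> \<circ> \<psi>)"
    using \<phi> tsS by (intro continuous_map_eq[OF continuous_map_id]) auto
  then have "continuous_map S S' \<psi>"
    unfolding S'_def using \<phi> tsS by (intro continuous_map_pullback') auto
  ultimately have "homeomorphic_maps S S' \<psi> \<phi>"
    using \<phi> \<psi> tsS tsS' by (simp add: homeomorphic_maps_def)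
  then have "topological_group G S'"
    using S topological_group_iso[OF _ G.is_group \<psi>iso] homeomorphic_map_maps by blast
  moreover have "openin X U" if "openin S' U" for U
  proof -
    from that obtain V where V: "openin S V" "U = \<phi> -` V \<inter> carrier G"
      by (auto simp: S'_def openin_pullback_topology)
    have "openin X {x \<in> topspace X. \<phi> x \<in> V}"
      using S V(1) homeo by (intro openin_continuous_map_preimage[of X Y])
        (auto simp: homeomorphic_imp_continuous_map)
    moreover have "{x \<in> topspace X. \<phi> x \<in> V} = U" using V(2) tsX by auto
    ultimately show ?thesis by simp
  qed
  ultimately have S'X: "S' = X" using min by (auto simp: minimal_group_def)
  have "openin S V" if V: "openin Y V" for V
  proof -
    have "openin S' {x \<in> topspace X. \<phi> x \<in> V}"
      unfolding S'X using V homeo by (intro openin_continuous_map_preimage[of X Y])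
        (auto simp: homeomorphic_imp_continuous_map)
    then obtain W where W: "openin S W" "{x \<in> topspace X. \<phi> x \<in> V} = \<phi> -` W \<inter> carrier G"
      by (auto simp: S'_def openin_pullback_topology)
    have "V \<subseteq> carrier H" "W \<subseteq> carrier H"
      using openin_subset[OF V] openin_subset[OF W(1)] tsY tsS by auto
    moreover have "\<phi> x \<in> V \<longleftrightarrow> \<phi> x \<in> W" if "x \<in> carrier G" for x
      using W(2) that tsX by auto
    ultimately have "V = W" using \<phi> by (metis subsetI subsetD subset_antisym)
    then show ?thesis using W(1) by simp
  qed
  then show "S = Y" using S by (auto simp: topology_eq)
qed

lemma minimal_group_quotient_finite:
  assumes G: "topological_group G X" and N: "N \<lhd> G" and fin: "finite (carrier (G Mod N))"
    and op: "\<And>U. U \<subseteq> carrier (G Mod N) \<Longrightarrow> openin X {x \<in> carrier G. N #>\<^bsub>G\<^esub> x \<in> U}"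
  shows "minimal_group (G Mod N) (quotient_group_topology G N X)"
proof -
  have "quotient_group_topology G N X = discrete_topology (carrier (G Mod N))"
    using op by (auto simp: topology_eq openin_quotient_group_topology)
  then show ?thesis
    using normal.factorgroup_is_group[OF N] fin by (intro minimal_group_finite) auto
qed

text \<open>The elements of this quotient are singleton cosets rather than group elements, so
  minimality has to be carried over by the coset map, an isomorphism and a homeomorphism.\<close>

lemma minimal_group_quotient_trivial:
  assumes min: "minimal_group G X" and N: "{\<one>\<^bsub>G\<^esub>} \<lhd> G"
  shows "minimal_group (G Mod {\<one>\<^bsub>G\<^esub>}) (quotient_group_topology G {\<one>\<^bsub>G\<^esub>} X)"
proof (rule minimal_group_iso[OF min])
  interpret normal "{\<one>\<^bsub>G\<^esub>}" G by fact
  have ts: "topspace X = carrier G" using min by (simp add: minimal_group_def topological_group_def)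
  have coset: "{\<one>\<^bsub>G\<^esub>} #>\<^bsub>G\<^esub> x = {x}" if "x \<in> carrier G" for x
    using that by (simp add: r_coset_def)
  then have inj: "inj_on (\<lambda>x. {\<one>\<^bsub>G\<^esub>} #>\<^bsub>G\<^esub> x) (carrier G)" by (auto intro!: inj_onI)
  show "group (G Mod {\<one>\<^bsub>G\<^esub>})" by (rule factorgroup_is_group)
  show "(\<lambda>x. {\<one>\<^bsub>G\<^esub>} #>\<^bsub>G\<^esub> x) \<in> iso G (G Mod {\<one>\<^bsub>G\<^esub>})"
    using r_coset_hom_Mod inj by (auto simp: iso_def bij_betw_def FactGroup_def RCOSETS_def)
  show "homeomorphic_map X (quotient_group_topology G {\<one>\<^bsub>G\<^esub>} X) (\<lambda>x. {\<one>\<^bsub>G\<^esub>} #>\<^bsub>G\<^esub> x)"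
    using quotient_map_quotient_group_topology[OF ts] inj ts by (simp add: homeomorphic_map_def)
qed

section \<open>Normal subgroups and generation by elementary matrices\<close>

context subfield_set
begin

lemma finite_carrier_SL:
  assumes "finite F" shows "finite (carrier (SL n F))"
proof (rule finite_subset)
  show "carrier (SL n F) \<subseteq> (\<lambda>f. mat n n f) ` Pi\<^sub>E ({..<n} \<times> {..<n}) (\<lambda>_. F)"
  proof
    fix A assume A: "A \<in> carrier (SL n F)"
    let ?f = "restrict (\<lambda>ij. A $$ ij) ({..<n} \<times> {..<n})"
    have "A = mat n n ?f" using A by (intro eq_matI) (auto simp: carrier_SL)
    moreover have "?f \<in> Pi\<^sub>E ({..<n} \<times> {..<n}) (\<lambda>_. F)" using A by (auto simp: carrier_SL)
    ultimately show "A \<in> (\<lambda>f. mat n n f) ` Pi\<^sub>E ({..<n} \<times> {..<n}) (\<lambda>_. F)" by blast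
  qed
  show "finite ((\<lambda>f. mat n n f) ` Pi\<^sub>E ({..<n} \<times> {..<n}) (\<lambda>_. F))"
    using assms by (intro finite_imageI finite_PiE) auto
qed

lemma SL_invariant_normal:
  assumes "N \<lhd> SL n F" shows "SL_invariant n F N"
proof -
  interpret normal N "SL n F" by fact
  have sub: "A \<in> carrier (SL n F)" if "A \<in> N" for A using that subset by auto
  have "adj_mat A \<in> N" if "A \<in> N" for A
    using m_inv_closed[OF that] inv_SL[OF sub[OF that]] by simp
  moreover have "A * B \<in> N" if "A \<in> N" "B \<in> N" for A B using subgroup.m_closed[OF subgroup_axioms that] by simp
  moreover have "g * A * adj_mat g \<in> N" if "g \<in> carrier (SL n F)" "A \<in> N" for g A
    using inv_op_closed2[OF that] inv_SL[OF that(1)] by simp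
  ultimately show ?thesis using sub by (auto simp: SL_invariant_def carrier_SL)
qed

text \<open>One column of Gaussian elimination by row additions alone. Rows from \<open>m\<close> on
  vanish in the finished columns, so adding multiples of them preserves those columns. The pivot
  becomes 1 by adding a multiple of a row below with a nonzero entry, not by scaling.\<close>

lemma SL_eliminate_column:
  assumes step: "\<And>X x c d. X \<in> R \<Longrightarrow> x \<in> F \<Longrightarrow> c < n \<Longrightarrow> d < n \<Longrightarrow> c \<noteq> d \<Longrightarrow> addrow x c d X \<in> R"
    and R: "R \<subseteq> carrier (SL n F)" and m: "m < n"
    and X: "X \<in> R" "\<And>a b. a < n \<Longrightarrow> b < m \<Longrightarrow> X $$ (a, b) = (if a = b then 1 else 0)"
  shows "\<exists>Y\<in>R. \<forall>a<n. \<forall>b<Suc m. Y $$ (a, b) = (if a = b then 1 else 0)"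
proof -
  define Q where "Q X \<longleftrightarrow> X \<in> R \<and> (\<forall>a<n. \<forall>b<m. X $$ (a, b) = (if a = b then 1 else 0))" for X
  have entry: "X $$ (a, b) \<in> F" if "X \<in> R" "a < n" "b < n" for X a b
    using that R by (auto simp: carrier_SL)
  have carr: "X \<in> carrier_mat n n" "det X = 1" if "X \<in> R" for X
    using that R by (auto simp: carrier_SL)
  have Q_step: "Q (addrow x c d X)" if "Q X" "x \<in> F" "c < n" "d < n" "c \<noteq> d" "m \<le> d" for X x c d
    unfolding Q_def
  proof (intro conjI allI impI)
    show "addrow x c d X \<in> R" using that step by (auto simp: Q_def)
    fix a b assume ab: "a < n" "b < m"
    have "X $$ (d, b) = 0" "X $$ (a, b) = (if a = b then 1 else 0)"
      using that ab by (auto simp: Q_def)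
    then show "addrow x c d X $$ (a, b) = (if a = b then 1 else 0)"
      using that ab m carr[of X] by (auto simp: Q_def)
  qed
  have pivot_below: "\<exists>Y. Q Y \<and> Y $$ (m, m) = 1" if "Q X" "m < r" "r < n" "X $$ (r, m) \<noteq> 0" for X r
  proof -
    let ?x = "(1 - X $$ (m, m)) * inverse (X $$ (r, m))"
    have "X \<in> R" using that by (simp add: Q_def)
    then have "?x \<in> F" using that m entry by (intro mult_in diff_in inverse_in) auto
    then have "Q (addrow ?x m r X)" using that m by (intro Q_step) auto
    moreover have "addrow ?x m r X $$ (m, m) = 1" using that m carr[OF \<open>X \<in> R\<close>] by (auto simp: mult.assoc)
    ultimately show ?thesis by blast
  qed
  have QX: "Q X" using X by (simp add: Q_def)
  have pivot: "\<exists>Y. Q Y \<and> Y $$ (m, m) = 1"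
  proof (cases "\<exists>r<n. m < r \<and> X $$ (r, m) \<noteq> 0")
    case True
    then show ?thesis using pivot_below[OF QX] by blast
  next
    case False
    then have below: "X $$ (r, m) = 0" if "m < r" "r < n" for r using that by blast
    note XR = carr[OF X(1)]
    show ?thesis
    \<comment> \<open>With only zeros below the pivot, invertibility makes the pivot nonzero; it is
      copied into row \<open>Suc m\<close>, which reduces to the previous case. In the last column
      there is no such row, but there the matrix is upper triangular and the determinant already
      forces the pivot to be 1.\<close>
    proof (cases "Suc m < n")
      case True
      note adj = adj_mat_SL[OF XR]
      \<comment> \<open>Column \<open>b\<close> of \<open>X\<close> is a unit vector, so multiplying
        by it reads off an entry of the inverse.\<close>
      have adj_m: "adj_mat X $$ (m, b) = 0" if "b < m" for b
      proof -
        have "(adj_mat X * X) $$ (m, b) = (\<Sum>l<n. adj_mat X $$ (m, l) * X $$ (l, b))"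
          by (rule index_mult_mat_sum[OF adj(1) XR(1)]) (use that m in auto)
        also have "\<dots> = (\<Sum>l<n. if l = b then adj_mat X $$ (m, l) else 0)"
          using X(2) that by (intro sum.cong) auto
        also have "\<dots> = adj_mat X $$ (m, b)" using that m by simp
        finally show ?thesis using adj(3) that m by simp
      qed
      have "X $$ (m, m) \<noteq> 0"
      proof
        assume zero: "X $$ (m, m) = 0"
        have "(adj_mat X * X) $$ (m, m) = (\<Sum>l<n. adj_mat X $$ (m, l) * X $$ (l, m))"
          by (rule index_mult_mat_sum[OF adj(1) XR(1) m m])
        also have "\<dots> = 0"
        proof (intro sum.neutral ballI)
          fix l assume "l \<in> {..<n}"
          then show "adj_mat X $$ (m, l) * X $$ (l, m) = 0"
            using adj_m[of l] zero below[of l] by (cases "l < m"; cases "l = m") auto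
        qed
        finally show False using adj(3) m by simp
      qed
      moreover have "addrow 1 (Suc m) m X $$ (Suc m, m) = X $$ (m, m)"
        using XR m True below[of "Suc m"] by auto
      ultimately have nz: "addrow 1 (Suc m) m X $$ (Suc m, m) \<noteq> 0" by simp
      have "Q (addrow 1 (Suc m) m X)" using QX m True by (intro Q_step) auto
      then show ?thesis by (rule pivot_below[OF _ lessI True nz])
    next
      case False
      then have nm: "n = Suc m" using m by simp
      have "upper_triangular X" using XR X(2) nm by (auto simp: upper_triangular_def)
      then have "det X = (\<Prod>i=0..<n. X $$ (i, i))"
        using XR by (simp add: det_upper_triangular[of _ n] prod_list_diag_prod)
      also have "\<dots> = X $$ (m, m) * (\<Prod>i=0..<m. X $$ (i, i))" by (simp add: nm)
      also have "(\<Prod>i=0..<m. X $$ (i, i)) = 1" using X(2) m by (intro prod.neutral) auto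
      finally show ?thesis using QX XR by auto
    qed
  qed
  have "\<exists>Y. Q Y \<and> Y $$ (m, m) = 1 \<and> (\<forall>a\<in>I. Y $$ (a, m) = 0)" if "I \<subseteq> {..<n} - {m}" for I
  proof -
    have "finite I" using that finite_subset by blast
    then show ?thesis using that
    proof (induction I rule: finite_induct)
      case (insert r I)
      then obtain Y where Y: "Q Y" "Y $$ (m, m) = 1" "\<forall>a\<in>I. Y $$ (a, m) = 0" by auto
      have r: "r < n" "r \<noteq> m" using insert.prems by auto
      have YR: "Y \<in> R" using Y by (simp add: Q_def)
      let ?Z = "addrow (- Y $$ (r, m)) r m Y"
      have QZ: "Q ?Z" using Y r m entry[OF YR] by (intro Q_step minus_in) auto
      have "?Z $$ (a, m) = (if a = r then 0 else Y $$ (a, m))" if "a < n" for a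
        using that r m carr[OF YR] Y(2) by auto
      moreover have "a < n" if "a \<in> insert r I" for a using that insert.prems by auto
      ultimately have "?Z $$ (m, m) = 1" "\<forall>a\<in>insert r I. ?Z $$ (a, m) = 0"
        using Y r m by auto
      then show ?case using QZ by blast
    qed (use pivot in auto)
  qed
  from this[OF subset_refl] obtain Y where "Q Y" "Y $$ (m, m) = 1" "\<forall>a\<in>{..<n} - {m}. Y $$ (a, m) = 0"
    by blast
  then show ?thesis by (intro bexI[of _ Y]) (auto simp: Q_def less_Suc_eq)
qed

text \<open>Elimination is run on the matrices \<open>h * g\<close> with \<open>h\<close> in
  \<open>N\<close>, starting from \<open>g\<close> itself and ending at the identity. Then
  \<open>g\<close> is the inverse of a member of \<open>N\<close>.\<close>

lemma SL_generated_by_addrow_mat: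
  assumes N: "SL_invariant n F N"
    and gen: "\<And>x c d. x \<in> F \<Longrightarrow> c < n \<Longrightarrow> d < n \<Longrightarrow> c \<noteq> d \<Longrightarrow> addrow_mat n x c d \<in> N"
    and ne: "N \<noteq> {}" and g: "g \<in> carrier (SL n F)"
  shows "g \<in> N"
proof -
  have gc: "g \<in> carrier_mat n n" "det g = 1" using g by (auto simp: carrier_SL)
  have Nc: "h \<in> carrier_mat n n" "det h = 1" "adj_mat h \<in> N" if "h \<in> N" for h
    using N that by (auto simp: SL_invariant_def)
  define R where "R = {X \<in> carrier (SL n F). \<exists>h\<in>N. X = h * g}"
  have one: "1\<^sub>m n \<in> N"
  proof -
    obtain h where h: "h \<in> N" using ne by blast
    then have "h * adj_mat h \<in> N" using N Nc(3) by (auto simp: SL_invariant_def)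
    then show ?thesis using adj_mat_SL(2)[OF Nc(1,2)[OF h]] by simp
  qed
  have step: "addrow x c d X \<in> R" if "X \<in> R" "x \<in> F" "c < n" "d < n" "c \<noteq> d" for X x c d
  proof -
    from that(1) obtain h where h: "h \<in> N" "X = h * g" and XS: "X \<in> carrier (SL n F)"
      by (auto simp: R_def)
    have Xc: "X \<in> carrier_mat n n" using XS by (simp add: carrier_SL)
    have "addrow x c d X = addrow_mat n x c d * X" by (rule addrow_mat[OF Xc that(4)])
    moreover have "addrow_mat n x c d * X = (addrow_mat n x c d * h) * g"
      unfolding h(2) using Nc(1)[OF h(1)] gc by (intro assoc_mult_mat[symmetric]) auto
    moreover have "addrow_mat n x c d * h \<in> N"
      using N gen[OF that(2-5)] h(1) by (auto simp: SL_invariant_def)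
    moreover have "addrow_mat n x c d * X \<in> carrier (SL n F)"
      using that XS by (intro mult_carrier_SL addrow_mat_carrier_SL)
    ultimately show ?thesis by (auto simp: R_def)
  qed
  have "\<exists>X\<in>R. \<forall>a<n. \<forall>b<m. X $$ (a, b) = (if a = b then 1 else 0)" if "m \<le> n" for m
    using that
  proof (induction m)
    case 0
    have "g \<in> R" using g one gc by (auto simp: R_def intro!: bexI[of _ "1\<^sub>m n"])
    then show ?case by auto
  next
    case (Suc m)
    then obtain X where "X \<in> R" "\<forall>a<n. \<forall>b<m. X $$ (a, b) = (if a = b then 1 else 0)" by auto
    then show ?case
      using Suc.prems SL_eliminate_column[of R n m X] step by (auto simp: R_def)
  qed
  from this[OF order_refl] obtain X where X: "X \<in> R" "\<forall>a<n. \<forall>b<n. X $$ (a, b) = (if a = b then 1 else 0)"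
    by blast
  then have "X = 1\<^sub>m n" by (intro eq_matI) (auto simp: R_def carrier_SL)
  then obtain h where h: "h \<in> N" "h * g = 1\<^sub>m n" using X(1) by (auto simp: R_def)
  have "adj_mat h = g" using h Nc(1,2)[OF h(1)] gc by (intro adj_mat_unique) auto
  then show ?thesis using Nc(3)[OF h(1)] by simp
qed

text \<open>In characteristic two the sign of a permutation is always 1, so permutation matrices lie
  in the special linear group. Conjugating by them moves the position \<open>(i, j)\<close> to any
  other off-diagonal position.\<close>

lemma addrow_mat_permute_mem:
  assumes char2: "CHAR('a) = 2" and N: "SL_invariant n F N"
    and mem: "addrow_mat n x i j \<in> N" and ij: "i < n" "j < n" "i \<noteq> j" and cd: "c < n" "d < n" "c \<noteq> d"
  shows "addrow_mat n x c d \<in> N"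
proof -
  \<comment> \<open>The first transposition sends \<open>c\<close> to \<open>i\<close> and
    \<open>d\<close> to \<open>d'\<close>. The second sends \<open>d'\<close> to \<open>j\<close>
    and leaves \<open>i\<close> alone, since \<open>i\<close> differs from both.\<close>
  define d' where "d' = Transposition.transpose c i d"
  define p where "p = Transposition.transpose d' j \<circ> Transposition.transpose c i"
  have d': "d' < n" "d' \<noteq> i" using ij cd by (auto simp: d'_def Transposition.transpose_def)
  have p: "p permutes {0..<n}"
    unfolding p_def using ij cd d' by (intro permutes_compose permutes_swap_id) auto
  have pc: "p c = i" "p d = j"
    using ij d'(2) by (simp_all add: p_def transpose_apply_other flip: d'_def)
  define P where "P = mat n n (\<lambda>(a, b). (1\<^sub>m n :: 'a mat) $$ (p a, b))"
  have detP: "det P = 1"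
    unfolding P_def using det_permute_rows[OF one_carrier_mat p, where 'a = 'a] minus_one_CHAR_2[OF char2]
    by (auto simp: sign_def)
  have pn: "p a < n" if "a < n" for a using permutes_in_image[OF p, of a] that by auto
  have P_index: "P $$ (a, b) = (if p a = b then 1 else 0)" if "a < n" "b < n" for a b
    using that pn by (auto simp: P_def)
  have Pc: "P \<in> carrier_mat n n" by (simp add: P_def)
  have PS: "P \<in> carrier (SL n F)" using detP Pc P_index by (auto simp: carrier_SL)
  have "P * addrow_mat n x i j = addcol x j i P"
    by (rule addcol_mat[symmetric]) (use Pc ij in auto)
  also have "\<dots> = addrow x c d P"
    using Pc ij cd pc P_index inj_eq[OF permutes_inj[OF p]]
    by (intro eq_matI) (auto simp: mat_addcol_def)
  also have "\<dots> = addrow_mat n x c d * P" by (rule addrow_mat[OF Pc cd(2)])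
  finally have eq: "P * addrow_mat n x i j = addrow_mat n x c d * P" .
  have "P * addrow_mat n x i j * adj_mat P \<in> N" using N PS mem by (auto simp: SL_invariant_def)
  moreover have "addrow_mat n x c d * P * adj_mat P = addrow_mat n x c d * (P * adj_mat P)"
    using Pc adj_mat_SL(1)[OF Pc detP] by (intro assoc_mult_mat) auto
  ultimately show ?thesis unfolding eq using adj_mat_SL(2)[OF Pc detP] by simp
qed

end

section \<open>Minimality and total minimality of the special linear groups\<close>

lemma (in local_top_field) minimal_group_SL:
  assumes F: "subfield_set F" and k: "1 \<le> k"
  shows "minimal_group (SL (2 ^ k) F) (SL_topology (2 ^ k) F T)"
proof -
  interpret subfield_set F by fact
  have top: "topological_group (SL (2 ^ k) F) (SL_topology (2 ^ k) F T)"
    by (rule topological_group_SL[OF F])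
  show ?thesis
  proof (cases "finite F")
    case True
    then show ?thesis
      using top finite_carrier_SL by (intro minimal_group_finite) (auto simp: topological_group_def)
  next
    case False
    have "S = SL_topology (2 ^ k) F T" if "topological_group (SL (2 ^ k) F) S"
      "\<And>U. openin S U \<Longrightarrow> openin (SL_topology (2 ^ k) F T) U" for S
    proof -
      interpret coarser_SL_topology T F "2 ^ k" k S
        by (rule coarser_SL_topology.intro[OF local_top_field_axioms F
              coarser_SL_topology_axioms.intro[OF refl k False that]])
      show ?thesis by (rule coarser_eq)
    qed
    then show ?thesis using top by (auto simp: minimal_group_def)
  qed
qed

lemma (in local_top_field) closed_normal_subgroup_SL:
  assumes F: "subfield_set F" and inf: "infinite F" and k: "1 \<le> k" and char2: "CHAR('a) = 2"
    and N: "N \<lhd> SL (2 ^ k) F" and cl: "closedin (SL_topology (2 ^ k) F T) N"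
  shows "N = {1\<^sub>m (2 ^ k)} \<or> N = carrier (SL (2 ^ k) F)"
proof (rule disjCI)
  assume ncarr: "N \<noteq> carrier (SL (2 ^ k) F)"
  interpret subfield_set F by fact
  interpret normal N "SL (2 ^ k) F" by fact
  let ?n = "2 ^ k :: nat"
  have n: "2 \<le> ?n" using power_increasing[OF k, of "2::nat"] by simp
  have inv: "SL_invariant ?n F N" by (rule SL_invariant_normal[OF N])
  have "A = 1\<^sub>m ?n" if A: "A \<in> N" for A
  proof -
    have AS: "A \<in> carrier (SL ?n F)" using A subset by auto
    then have Ac: "A \<in> carrier_mat ?n ?n" "det A = 1" by (auto simp: carrier_SL)
    note adj = adj_mat_SL[OF Ac]
    show ?thesis
    proof (cases "\<exists>c. A = c \<cdot>\<^sub>m 1\<^sub>m ?n")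
      case True
      then obtain c where c: "A = c \<cdot>\<^sub>m 1\<^sub>m ?n" by blast
      \<comment> \<open>In characteristic two the only square root of 1 is 1, so a scalar matrix of
        determinant 1 is the identity.\<close>
      have "x ^ (2 ^ m) = 1 \<Longrightarrow> x = 1" for x :: 'a and m
      proof (induction m)
        case (Suc m)
        then have "(x ^ (2 ^ m))\<^sup>2 = 1" by (simp add: power_mult[symmetric] mult.commute)
        then show ?case using Suc.IH minus_one_CHAR_2[OF char2] power2_eq_1_iff by metis
      qed simp
      moreover have "c ^ (2 ^ k) = 1" using Ac(2) c by simp
      ultimately have "c = 1" by blast
      then show ?thesis using c by auto
    next
      case False
      then obtain p q i j where pq: "p < ?n" "q < ?n" "p \<noteq> q" and ij: "i < ?n" "j < ?n" "i \<noteq> j"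
        and neq: "A $$ (i, p) * adj_mat A $$ (q, j) \<noteq> (if i = p \<and> j = q then 1 else 0)"
        using nonscalar_witness[OF n Ac(1) adj(1,2)] by metis
      define \<gamma> where "\<gamma> = A $$ (i, p) * adj_mat A $$ (q, j) - (if i = p \<and> j = q then 1 else 0)"
      have nz: "\<gamma> \<noteq> 0" using neq by (simp add: \<gamma>_def)
      have \<gamma>: "\<gamma> \<in> F"
        unfolding \<gamma>_def using AS pq ij adj_mat_in[of A ?n q j] by (auto simp: carrier_SL intro!: diff_in mult_in)
      \<comment> \<open>Here \<open>A\<close> is over \<open>F\<close>, hence so is \<gamma>, and
        the free parameter can be divided by it: every \<open>x\<close> in \<open>F\<close> is
        reached, and closedness of \<open>N\<close> keeps the limit.\<close>
      have mem: "addrow_mat ?n x i j \<in> N" if x: "x \<in> F" for x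
      proof (rule limitin_closedin[OF _ cl])
        let ?y = "x * inverse \<gamma>" and ?L = "atin_within T 0 F"
        have y: "?y \<in> F" using x \<gamma> by (intro mult_in inverse_in)
        have "eventually (\<lambda>t. t \<in> F \<and> t \<noteq> 0) ?L"
          using openin_topspace[of T] by (auto simp: eventually_atin_within)
        then show ev: "eventually (\<lambda>t. squeezed_commutator ?n p q i j A ?y t \<in> N) ?L"
          by eventually_elim (use squeezed_commutator_mem[OF inv A y _ _ pq ij] in blast)
        show "?L \<noteq> bot"
          using infinite_subfield_zero_limit_point diff_in inverse_in inf by blast
        have "limitin (mat_topology ?n T) (squeezed_commutator ?n p q i j A ?y) (addrow_mat ?n (?y * \<gamma>) i j) ?L"
          unfolding \<gamma>_def by (rule lim_squeezed_commutator[OF Ac pq ij])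
        then have "limitin (mat_topology ?n T) (squeezed_commutator ?n p q i j A ?y) (addrow_mat ?n x i j) ?L"
          using nz by (simp add: mult.assoc)
        moreover have "addrow_mat ?n x i j \<in> carrier (SL ?n F)" using x ij by (intro addrow_mat_carrier_SL)
        moreover have "eventually (\<lambda>t. squeezed_commutator ?n p q i j A ?y t \<in> carrier (SL ?n F)) ?L"
          using ev by eventually_elim (use subset in auto)
        ultimately show "limitin (SL_topology ?n F T) (squeezed_commutator ?n p q i j A ?y) (addrow_mat ?n x i j) ?L"
          by (simp add: limitin_SL_topology)
      qed
      have "carrier (SL ?n F) \<subseteq> N"
        using SL_generated_by_addrow_mat[OF inv] addrow_mat_permute_mem[OF char2 inv mem ij] A by blast
      then show ?thesis using ncarr subset by auto
    qed
  qed
  moreover have "1\<^sub>m ?n \<in> N" using subgroup.one_closed[OF subgroup_axioms] by simp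
  ultimately show "N = {1\<^sub>m ?n}" by blast
qed

text \<open>Three kinds of quotient occur: all of them are finite and discrete for finite
  \<open>F\<close>; for infinite \<open>F\<close> the quotient is a copy of the group, minimal by
  the first part, or a single point.\<close>

lemma (in local_top_field) totally_minimal_group_SL:
  assumes F: "subfield_set F" and k: "1 \<le> k" and char2: "CHAR('a) = 2"
  shows "totally_minimal_group (SL (2 ^ k) F) (SL_topology (2 ^ k) F T)"
  unfolding totally_minimal_group_def
proof (intro conjI allI impI)
  interpret subfield_set F by fact
  let ?G = "SL (2 ^ k) F" and ?\<tau> = "SL_topology (2 ^ k) F T"
  show top: "topological_group ?G ?\<tau>" by (rule topological_group_SL[OF F])
  then have ts: "topspace ?\<tau> = carrier ?G" and Hd: "Hausdorff_space ?\<tau>"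
    by (auto simp: topological_group_def)
  fix N assume "N \<lhd> ?G \<and> closedin ?\<tau> N"
  then have N: "N \<lhd> ?G" and cl: "closedin ?\<tau> N" by auto
  interpret normal N ?G by (rule N)
  have Mod: "carrier (?G Mod N) = (\<lambda>x. N #>\<^bsub>?G\<^esub> x) ` carrier ?G"
    by (auto simp: FactGroup_def RCOSETS_def)
  show "minimal_group (?G Mod N) (quotient_group_topology ?G N ?\<tau>)"
  proof (cases "finite F")
    case True
    then have fin: "finite (carrier ?G)" by (rule finite_carrier_SL)
    then have "?\<tau> = discrete_topology (carrier ?G)"
      using finite_topspace_imp_discrete_topology[OF ts] Hd by blast
    then show ?thesis
      using fin Mod by (intro minimal_group_quotient_finite top N) auto
  next
    case False
    then consider "N = {1\<^sub>m (2 ^ k)}" | "N = carrier ?G"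
      using closed_normal_subgroup_SL[OF F _ k char2 N cl] by blast
    then show ?thesis
    proof cases
      case 1
      then show ?thesis
        using minimal_group_quotient_trivial[OF minimal_group_SL[OF F k]] N by simp
    next
      case 2
      then have coset: "N #>\<^bsub>?G\<^esub> x = carrier ?G" if "x \<in> carrier ?G" for x
        using that coset_join2 subgroup_axioms by blast
      have "openin ?\<tau> {x \<in> carrier ?G. N #>\<^bsub>?G\<^esub> x \<in> U}" for U
      proof -
        have "{x \<in> carrier ?G. N #>\<^bsub>?G\<^esub> x \<in> U} = (if carrier ?G \<in> U then carrier ?G else {})"
          using coset by auto
        then show ?thesis using openin_topspace[of ?\<tau>] ts by simp
      qed
      moreover have "carrier (?G Mod N) \<subseteq> {carrier ?G}" unfolding Mod using coset by auto
      then have "finite (carrier (?G Mod N))" by (rule finite_subset) simp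
      ultimately show ?thesis by (intro minimal_group_quotient_finite top N)
    qed
  qed
qed

theorem corollary5p2:
  fixes T :: "'a::field topology" and F :: "'a set"
  assumes "local_field T" and "subfield F class_ring"
  shows "(\<forall>k\<ge>1. minimal_group (SL (2 ^ k) F) (SL_topology (2 ^ k) F T)) \<and>
    (CHAR('a) = 2 \<longrightarrow>
      (\<forall>k\<ge>1. totally_minimal_group (SL (2 ^ k) F) (SL_topology (2 ^ k) F T)))"
proof -
  interpret local_top_field T
    using assms(1) unfolding local_field_def
    by (intro local_top_field.intro top_field.intro local_top_field_axioms.intro) blast+
  have "subfield_set F" by (rule subfield_set_class_ring[OF assms(2)])
  then show ?thesis
    using minimal_group_SL totally_minimal_group_SL by blast
qed

end
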